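(* For all integers $k \geq 4$ and $r \geq 2$, let $R = R(C_k;r)$ denote the least integer $m$ such that $K_m \rightarrow (C_k)_r$. Then there exists a graph $H$ on $|V(H)| = k^{15k^3} R^{10k^2}$ vertices satisfying $\operatorname{girth}(H) = k$ and $H \rightarrow (C_k)_r$.
   Context: All graphs are finite and simple. $C_k$ is the cycle of length $k$ and $K_m$ the complete graph on $m$ vertices. For graphs $H$, $F$ and an integer $r \geq 2$, we write $H \rightarrow (F)_r$ if every colouring of the edges of $H$ with $r$ colours yields a monochromatic (not necessarily induced) copy of $F$. The girth of a graph is the length of its shortest cycle. *)

theory Defs
  imports "HOL-Library.Ramsey" "HOL-Library.Extended_Nat"
begin

record 'a graph =
  verts :: "'a set"
  edges :: "'a set set"

definition finite_simple_graph :: "'a graph \<Rightarrow> bool" where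
  "finite_simple_graph G \<longleftrightarrow> finite (verts G) \<and> edges G \<subseteq> nsets (verts G) 2"

definition complete_graph :: "nat \<Rightarrow> nat graph" where
  "complete_graph m = \<lparr>verts = {..<m}, edges = nsets {..<m} 2\<rparr>"

text \<open>Meaningful only for \<open>k \<ge> 3\<close>; otherwise this is not a simple cycle.\<close>

definition cycle_graph :: "nat \<Rightarrow> nat graph" where
  "cycle_graph k = \<lparr>verts = {..<k}, edges = {{i, Suc i mod k} | i. i < k}\<rparr>"

text \<open>Copies are not necessarily induced: \<open>f\<close> need not reflect edges.\<close>

definition is_copy :: "('b \<Rightarrow> 'a) \<Rightarrow> 'b graph \<Rightarrow> 'a graph \<Rightarrow> bool" where
  "is_copy f F G \<longleftrightarrow> inj_on f (verts F) \<and> f ` verts F \<subseteq> verts G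
     \<and> (\<forall>e\<in>edges F. f ` e \<in> edges G)"

definition arrows :: "'a graph \<Rightarrow> 'b graph \<Rightarrow> nat \<Rightarrow> bool" where
  "arrows H F r \<longleftrightarrow>
     (\<forall>c :: 'a set \<Rightarrow> nat. (\<forall>e\<in>edges H. c e < r) \<longrightarrow>
        (\<exists>f. is_copy f F H \<and> (\<exists>i<r. \<forall>e\<in>edges F. c (f ` e) = i)))"

definition ramsey_number :: "'b graph \<Rightarrow> nat \<Rightarrow> nat" where
  "ramsey_number F r = (LEAST m. arrows (complete_graph m) F r)"

text \<open>The girth of an acyclic graph is \<open>\<infinity>\<close>, the infimum of the empty set.\<close>

definition girth :: "'a graph \<Rightarrow> enat" where
  "girth G = Inf {enat l | l. 3 \<le> l \<and> (\<exists>f. is_copy f (cycle_graph l) G)}"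

end

theory Submission
  imports Defs "HOL-Analysis.Convex" "HOL-Library.FuncSet"
begin

text \<open>
Take a random graph on \<open>n = m ^ (k - 1)\<close> vertices with edge probability \<open>b / m ^ (k - 2)\<close> and delete one
edge from every cycle shorter than \<open>k\<close>; isolated vertices are added to reach the prescribed order.
If a colouring of what remains has no monochromatic \<open>C\<^sub>k\<close>, then hypergraph containers enclose each colour
class in one of few sets of edges of \<open>K\<^sub>n\<close> that contain few copies of \<open>C\<^sub>k\<close>, and each container is
determined by a small subset of its colour class. Averaging over vertex sets of size \<open>R\<close>, a proportion
\<open>1 / R\<^sup>2\<close> of all pairs lies outside the chosen containers. The random graph has many edges among these
pairs, more than were deleted, simultaneously for all choices of containers: a contradiction.

The container lemma needs no iteration. Let \<open>A\<close> be a \<open>p\<close>-random set conditioned to be independent. While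
some small set \<open>L\<close> is noticeably less likely to be contained in \<open>A\<close> than \<open>p ^ |L|\<close>, ask whether \<open>L\<close>
is contained in the given independent set: if so, put \<open>L\<close> into the fingerprint and pass to the link of \<open>L\<close>; if
not, forbid \<open>L\<close>. The probability of independence never increases, drops by a constant factor at each
positive answer, and is at least \<open>(1 - p) ^ |V|\<close>, so that the fingerprint is small. When the process stops,
a second moment argument shows that the minimal forbidden sets are so sparse that they cannot cover many
edges inside the container.
\<close>

section \<open>Random subsets and down-closed families\<close>

text \<open>The probability that a random subset of \<open>V\<close>, containing each element
  independently with probability \<open>p\<close>, equals \<open>A\<close>. Expectations are written
  as finite sums against this weight.\<close>

definition subset_weight :: "real \<Rightarrow> 'a set \<Rightarrow> 'a set \<Rightarrow> real" where
  "subset_weight p V A = p ^ card A * (1 - p) ^ card (V - A)"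

lemma sum_Pow_split:
  fixes g :: "'a set \<Rightarrow> real"
  assumes "finite V" "F \<subseteq> V"
  shows "(\<Sum>A\<in>Pow V. g A) = (\<Sum>B\<in>Pow (V - F). \<Sum>C\<in>Pow F. g (B \<union> C))"
proof -
  have e: "A - F \<union> A \<inter> F = A" for A by blast
  have "(\<Sum>A\<in>Pow V. g A) = (\<Sum>(B, C)\<in>Pow (V - F) \<times> Pow F. g (B \<union> C))"
    by (rule sum.reindex_bij_witness[of _ "\<lambda>(B, C). B \<union> C" "\<lambda>A. (A - F, A \<inter> F)"])
       (use assms in \<open>auto simp: e\<close>)
  then show ?thesis by (simp add: sum.cartesian_product)
qed

text \<open>By independence each element of \<open>V \<inter> D\<close> contributes the factor
  \<open>1 - p + p * s\<close> and every other element the factor 1. The case \<open>D = {}\<close>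
  gives the total mass, and \<open>s = 1/2\<close> later serves as an exponential moment.\<close>

lemma sum_subset_weight_power_card_Int:
  assumes "finite V"
  shows "(\<Sum>A\<in>Pow V. subset_weight p V A * s ^ card (A \<inter> D)) = (1 - p + p * s) ^ card (V \<inter> D)"
proof -
  have "(\<Sum>A\<in>Pow V. subset_weight p V A * s ^ card (A \<inter> D)) =
     (\<Sum>A\<in>Pow V. (\<Prod>a\<in>A. if a \<in> D then p * s else p) * (\<Prod>b\<in>V - A. 1 - p))"
  proof (intro sum.cong refl)
    fix A assume "A \<in> Pow V"
    then have fA: "finite A" using finite_subset[OF _ assms] by simp
    have "(\<Prod>a\<in>A. if a \<in> D then p * s else p) = (\<Prod>a\<in>A. p * (if a \<in> D then s else 1))"
      by (intro prod.cong) auto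
    also have "\<dots> = p ^ card A * s ^ card (A \<inter> D)"
      using prod.inter_restrict[OF fA, of "\<lambda>_. s" D] by (simp add: prod.distrib)
    finally show "subset_weight p V A * s ^ card (A \<inter> D) =
        (\<Prod>a\<in>A. if a \<in> D then p * s else p) * (\<Prod>b\<in>V - A. 1 - p)"
      by (simp add: subset_weight_def)
  qed
  also have "\<dots> = (\<Prod>v\<in>V. (if v \<in> D then p * s else p) + (1 - p))"
    using assms by (simp add: prod_add)
  also have "\<dots> = (\<Prod>v\<in>V. if v \<in> D then 1 - p + p * s else 1)"
    by (intro prod.cong) auto
  also have "\<dots> = (1 - p + p * s) ^ card (V \<inter> D)"
    using prod.inter_restrict[OF assms, of "\<lambda>_. 1 - p + p * s" D] by simp
  finally show ?thesis .
qed

lemma sum_subset_weight: "finite V \<Longrightarrow> (\<Sum>A\<in>Pow V. subset_weight p V A) = 1"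
  using sum_subset_weight_power_card_Int[of V p 1 "{}"] by simp

lemma subset_weight_Un:
  assumes "finite V" "F \<subseteq> V" "B \<subseteq> V - F" "C \<subseteq> F"
  shows "subset_weight p V (B \<union> C) = subset_weight p (V - F) B * subset_weight p F C"
proof -
  have fin: "finite B" "finite C" "finite F"
    using finite_subset[OF assms(2,1)] finite_subset[OF assms(3)] finite_subset[OF assms(4)] assms(1) by auto
  have c: "card (B \<union> C) = card B + card C" using assms fin by (intro card_Un_disjoint) auto
  have "card (V - (B \<union> C)) = card ((V - F - B) \<union> (F - C))"
    using assms by (intro arg_cong[of _ _ card]) blast
  also have "\<dots> = card (V - F - B) + card (F - C)"
    using assms(1) fin by (intro card_Un_disjoint) auto
  finally show ?thesis unfolding subset_weight_def c by (simp only: power_add mult_ac)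
qed

lemma subset_weight_nonneg: "0 \<le> p \<Longrightarrow> p \<le> 1 \<Longrightarrow> 0 \<le> subset_weight p V A"
  by (simp add: subset_weight_def)

text \<open>Two independent events are intersected: \<open>F \<subseteq> A\<close> depends on
  \<open>A \<inter> F\<close> only, \<open>P (A - F)\<close> on \<open>A - F\<close> only.\<close>

lemma sum_subset_weight_superset:
  assumes "finite V" "F \<subseteq> V"
  shows "(\<Sum>A | A \<subseteq> V \<and> F \<subseteq> A \<and> P (A - F). subset_weight p V A)
    = p ^ card F * (\<Sum>A | A \<subseteq> V \<and> P (A - F). subset_weight p V A)"
proof -
  define s where "s B = subset_weight p (V - F) B * of_bool (P B)" for B
  have fF: "finite F" by (rule finite_subset[OF assms(2,1)])
  have "(\<Sum>A | A \<subseteq> V \<and> F \<subseteq> A \<and> P (A - F). subset_weight p V A) =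
     (\<Sum>A\<in>Pow V. subset_weight p V A * of_bool (F \<subseteq> A \<and> P (A - F)))"
    using assms by (intro sum.mono_neutral_cong_left) auto
  also have "\<dots> = (\<Sum>B\<in>Pow (V - F). \<Sum>C\<in>Pow F. subset_weight p V (B \<union> C) * of_bool (F \<subseteq> B \<union> C \<and> P (B \<union> C - F)))"
    by (rule sum_Pow_split[OF assms])
  also have "\<dots> = (\<Sum>B\<in>Pow (V - F). \<Sum>C\<in>Pow F. s B * (if F = C then subset_weight p F C else 0))"
  proof (intro sum.cong refl)
    fix B C assume BC: "B \<in> Pow (V - F)" "C \<in> Pow F"
    then have "B \<union> C - F = B" "F \<subseteq> B \<union> C \<longleftrightarrow> F = C" by auto
    with BC show "subset_weight p V (B \<union> C) * of_bool (F \<subseteq> B \<union> C \<and> P (B \<union> C - F)) = s B * (if F = C then subset_weight p F C else 0)"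
      using assms by (auto simp: subset_weight_Un s_def)
  qed
  also have "\<dots> = (\<Sum>B\<in>Pow (V - F). s B * p ^ card F)"
    using fF by (simp add: sum_distrib_left[symmetric] sum.delta subset_weight_def)
  finally have 1: "(\<Sum>A | A \<subseteq> V \<and> F \<subseteq> A \<and> P (A - F). subset_weight p V A) = (\<Sum>B\<in>Pow (V - F). s B * p ^ card F)" .
  have "(\<Sum>A | A \<subseteq> V \<and> P (A - F). subset_weight p V A) = (\<Sum>A\<in>Pow V. subset_weight p V A * of_bool (P (A - F)))"
    using assms by (intro sum.mono_neutral_cong_left) auto
  also have "\<dots> = (\<Sum>B\<in>Pow (V - F). \<Sum>C\<in>Pow F. subset_weight p V (B \<union> C) * of_bool (P (B \<union> C - F)))"
    by (rule sum_Pow_split[OF assms])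
  also have "\<dots> = (\<Sum>B\<in>Pow (V - F). \<Sum>C\<in>Pow F. s B * subset_weight p F C)"
  proof (intro sum.cong refl)
    fix B C assume BC: "B \<in> Pow (V - F)" "C \<in> Pow F"
    then have "B \<union> C - F = B" by auto
    with BC show "subset_weight p V (B \<union> C) * of_bool (P (B \<union> C - F)) = s B * subset_weight p F C"
      using assms by (auto simp: subset_weight_Un s_def)
  qed
  also have "\<dots> = (\<Sum>B\<in>Pow (V - F). s B)"
    by (simp add: sum_distrib_left[symmetric] sum_subset_weight[OF fF])
  finally have 2: "(\<Sum>A | A \<subseteq> V \<and> P (A - F). subset_weight p V A) = (\<Sum>B\<in>Pow (V - F). s B)" .
  have "(\<Sum>B\<in>Pow (V - F). s B * p ^ card F) = (\<Sum>B\<in>Pow (V - F). s B) * p ^ card F"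
    by (simp only: sum_distrib_right)
  with 1 2 show ?thesis by simp
qed

section \<open>Down-closed families, their probabilities and their links\<close>

definition family_weight :: "real \<Rightarrow> 'a set \<Rightarrow> 'a set set \<Rightarrow> real" where
  "family_weight p V D = (\<Sum>A\<in>D. subset_weight p V A)"

definition down_closed :: "'a set set \<Rightarrow> bool" where
  "down_closed D \<longleftrightarrow> (\<forall>A\<in>D. \<forall>B\<subseteq>A. B \<in> D)"

text \<open>Members of the link may meet \<open>L\<close>. Thus the link of a down-closed family is
  a subfamily of it on the same ground set, open to the same induction.\<close>

definition link :: "'a set \<Rightarrow> 'a set set \<Rightarrow> 'a set set" where
  "link L D = {A. A \<union> L \<in> D}"

lemma down_closedD: "down_closed D \<Longrightarrow> A \<in> D \<Longrightarrow> B \<subseteq> A \<Longrightarrow> B \<in> D"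
  unfolding down_closed_def by blast

lemma down_closedI: "(\<And>A B. A \<in> D \<Longrightarrow> B \<subseteq> A \<Longrightarrow> B \<in> D) \<Longrightarrow> down_closed D"
  unfolding down_closed_def by blast

lemma down_closed_link: "down_closed D \<Longrightarrow> down_closed (link L D)"
  by (rule down_closedI) (auto simp: link_def elim: down_closedD)

lemma link_subset: "down_closed D \<Longrightarrow> link L D \<subseteq> D"
  by (auto simp: link_def elim: down_closedD)

text \<open>For \<open>A\<close> containing \<open>F\<close>, membership in \<open>D\<close> is
  decided by \<open>A - F\<close>, hence independently of \<open>F \<subseteq> A\<close>. So,
  conditioned on \<open>A \<in> D\<close>, the probability of \<open>F \<subseteq> A\<close> is
  \<open>p ^ card F\<close> times the ratio of the weights of the link and of
  \<open>D\<close>.\<close>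

lemma family_weight_superset:
  assumes "finite V" "F \<subseteq> V" "D \<subseteq> Pow V"
  shows "family_weight p V {A\<in>D. F \<subseteq> A} = p ^ card F * family_weight p V (link F D)"
proof -
  have e1: "F \<subseteq> A \<Longrightarrow> A - F \<union> F = A" and e2: "A - F \<union> F = A \<union> F" for A :: "'a set" by auto
  have "A \<in> D \<and> F \<subseteq> A \<longleftrightarrow> A \<subseteq> V \<and> F \<subseteq> A \<and> A - F \<union> F \<in> D" for A
    using e1[of A] assms(3) by (cases "F \<subseteq> A") force+
  then have 1: "{A\<in>D. F \<subseteq> A} = {A. A \<subseteq> V \<and> F \<subseteq> A \<and> A - F \<union> F \<in> D}" by blast
  have "A \<union> F \<in> D \<longleftrightarrow> A \<subseteq> V \<and> A - F \<union> F \<in> D" for A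
    unfolding e2 using assms(3) by fastforce
  then have 2: "link F D = {A. A \<subseteq> V \<and> A - F \<union> F \<in> D}" unfolding link_def by blast
  show ?thesis
    unfolding family_weight_def 1 2 by (rule sum_subset_weight_superset[OF assms(1,2)])
qed

lemma family_weight_mono:
  assumes "finite V" "D \<subseteq> D'" "D' \<subseteq> Pow V" "0 \<le> p" "p \<le> 1"
  shows "family_weight p V D \<le> family_weight p V D'"
  unfolding family_weight_def using assms finite_subset[OF assms(3)] by (intro sum_mono2 subset_weight_nonneg) auto

lemma family_weight_bounds:
  assumes "finite V" "D \<subseteq> Pow V" "{} \<in> D" "0 \<le> p" "p \<le> 1"
  shows "(1 - p) ^ card V \<le> family_weight p V D" "family_weight p V D \<le> 1"
proof -
  have "family_weight p V {{}} \<le> family_weight p V D" using assms by (intro family_weight_mono) auto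
  then show "(1 - p) ^ card V \<le> family_weight p V D" by (simp add: family_weight_def subset_weight_def)
  have "family_weight p V D \<le> family_weight p V (Pow V)" using assms by (intro family_weight_mono) auto
  then show "family_weight p V D \<le> 1" using sum_subset_weight[OF assms(1)] by (simp add: family_weight_def)
qed

text \<open>In terms of the random set conditioned to lie in \<open>D\<close>: each
  \<open>L \<in> D\<close> with fewer than \<open>k\<close> elements is contained in it with
  probability at least \<open>(1 - \<delta>) * p ^ card L\<close>. This is the stopping condition of
  the process that produces containers.\<close>

definition spread :: "real \<Rightarrow> real \<Rightarrow> nat \<Rightarrow> 'a set \<Rightarrow> 'a set set \<Rightarrow> bool" where
  "spread p \<delta> k V D \<longleftrightarrow> (\<forall>L\<in>D. card L < k \<longrightarrow> (1 - \<delta>) * family_weight p V D \<le> family_weight p V (link L D))"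

text \<open>\<open>f I\<close> is the family at a leaf of a decision tree, \<open>S\<close> the
  union of the sets that received a positive answer and \<open>t\<close> the number of such answers.
  Constancy of \<open>f\<close> on the whole range \<open>S \<subseteq> S' \<subseteq> I\<close>,
  rather than only at \<open>S\<close>, is what lets the induction enlarge \<open>S\<close> by
  \<open>L\<close>.\<close>

lemma exists_spread_refinement:
  assumes V: "finite V" and p: "0 < p" "p < 1" and \<delta>: "0 \<le> \<delta>" "\<delta> < 1"
    and "D \<subseteq> Pow V" "down_closed D"
  shows "\<exists>f. \<forall>I\<in>D. I \<in> f I \<and> f I \<subseteq> D \<and> down_closed (f I) \<and> spread p \<delta> k V (f I) \<and>
    (\<exists>S\<subseteq>I. \<exists>t. card S \<le> k * t \<and> family_weight p V (f I) \<le> (1 - \<delta>) ^ t * family_weight p V D \<and>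
      (\<forall>S'. S \<subseteq> S' \<longrightarrow> S' \<subseteq> I \<longrightarrow> f S' = f I))"
  using assms(6,7)
proof (induction "card D" arbitrary: D rule: less_induct)
  case less
  have finD: "finite D" using finite_subset[OF less.prems(1)] V by simp
  show ?case
  proof (cases "spread p \<delta> k V D")
    case True
    then show ?thesis using less.prems
      by (intro exI[of _ "\<lambda>_. D"] ballI conjI exI[of _ "{}"] exI[of _ "0::nat"]) simp_all
  next
    case False
    then obtain L where L: "L \<in> D" "card L < k" and bL: "family_weight p V (link L D) < (1 - \<delta>) * family_weight p V D"
      unfolding spread_def by force
    define D1 where "D1 = link L D"
    define D2 where "D2 = {A\<in>D. \<not> L \<subseteq> A}"
    have nn: "0 \<le> family_weight p V D" unfolding family_weight_def using p by (intro sum_nonneg subset_weight_nonneg) auto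
    \<comment> \<open>The strict loss of weight shows that passing to the link removes some set, so
      the induction on \<open>card D\<close> applies.\<close>
    have "D1 \<noteq> D" using bL \<delta> nn mult_right_mono[of "1 - \<delta>" 1 "family_weight p V D"] unfolding D1_def by auto
    then have D1: "D1 \<subset> D" using link_subset[OF less.prems(2)] D1_def by auto
    have D2: "D2 \<subset> D" using L D2_def by auto
    have d1: "down_closed D1" using down_closed_link[OF less.prems(2)] D1_def by auto
    have d2: "down_closed D2"
      by (rule down_closedI) (use down_closedD[OF less.prems(2)] in \<open>auto simp: D2_def\<close>)
    have "D1 \<subseteq> Pow V" "D2 \<subseteq> Pow V" using D1 D2 less.prems(1) by auto
    note IH = less.hyps[OF psubset_card_mono[OF finD D1] this(1) d1]
      less.hyps[OF psubset_card_mono[OF finD D2] this(2) d2]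
    from IH(1) obtain f1 where f1: "\<forall>I\<in>D1. I \<in> f1 I \<and> f1 I \<subseteq> D1 \<and> down_closed (f1 I) \<and> spread p \<delta> k V (f1 I) \<and>
    (\<exists>S\<subseteq>I. \<exists>t. card S \<le> k * t \<and> family_weight p V (f1 I) \<le> (1 - \<delta>) ^ t * family_weight p V D1 \<and>
      (\<forall>S'. S \<subseteq> S' \<longrightarrow> S' \<subseteq> I \<longrightarrow> f1 S' = f1 I))" ..
    from IH(2) obtain f2 where f2: "\<forall>I\<in>D2. I \<in> f2 I \<and> f2 I \<subseteq> D2 \<and> down_closed (f2 I) \<and> spread p \<delta> k V (f2 I) \<and>
    (\<exists>S\<subseteq>I. \<exists>t. card S \<le> k * t \<and> family_weight p V (f2 I) \<le> (1 - \<delta>) ^ t * family_weight p V D2 \<and>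
      (\<forall>S'. S \<subseteq> S' \<longrightarrow> S' \<subseteq> I \<longrightarrow> f2 S' = f2 I))" ..
    define f where "f S = (if L \<subseteq> S then f1 S else f2 S)" for S
    show ?thesis
    proof (intro exI[of _ f] ballI)
      fix I assume I: "I \<in> D"
      show "I \<in> f I \<and> f I \<subseteq> D \<and> down_closed (f I) \<and> spread p \<delta> k V (f I) \<and>
        (\<exists>S\<subseteq>I. \<exists>t. card S \<le> k * t \<and> family_weight p V (f I) \<le> (1 - \<delta>) ^ t * family_weight p V D \<and>
        (\<forall>S'. S \<subseteq> S' \<longrightarrow> S' \<subseteq> I \<longrightarrow> f S' = f I))"
      proof (cases "L \<subseteq> I")
        case True
        then have I1: "I \<in> D1" using I by (simp add: D1_def link_def Un_absorb2)
        from bspec[OF f1 this] obtain S t where S: "S \<subseteq> I" "card S \<le> k * t"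
          "family_weight p V (f1 I) \<le> (1 - \<delta>) ^ t * family_weight p V D1" "\<And>S'. S \<subseteq> S' \<Longrightarrow> S' \<subseteq> I \<Longrightarrow> f1 S' = f1 I" by blast
        have fI: "f I = f1 I" using True by (simp add: f_def)
        \<comment> \<open>A positive answer adds fewer than \<open>k\<close> elements to the
          fingerprint and gains a factor \<open>1 - \<delta>\<close> in the weight.\<close>
        have "card (S \<union> L) \<le> k * t + k" using card_Un_le[of S L] S(2) L(2) by linarith
        moreover have "(1 - \<delta>) ^ t * family_weight p V D1 \<le> (1 - \<delta>) ^ t * ((1 - \<delta>) * family_weight p V D)"
          using bL \<delta> unfolding D1_def by (intro mult_left_mono) auto
        ultimately have "card (S \<union> L) \<le> k * Suc t" "family_weight p V (f I) \<le> (1 - \<delta>) ^ Suc t * family_weight p V D"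
          using S(3) fI by (simp_all add: mult_ac)
        moreover have "f S' = f I" if "S \<union> L \<subseteq> S'" "S' \<subseteq> I" for S'
          using S(4)[of S'] that True by (simp add: f_def)
        moreover have "S \<union> L \<subseteq> I" using S(1) True by simp
        ultimately have "\<exists>S\<subseteq>I. \<exists>t. card S \<le> k * t \<and> family_weight p V (f I) \<le> (1 - \<delta>) ^ t * family_weight p V D \<and>
          (\<forall>S'. S \<subseteq> S' \<longrightarrow> S' \<subseteq> I \<longrightarrow> f S' = f I)" by metis
        moreover have "I \<in> f I" "f I \<subseteq> D" "down_closed (f I)" "spread p \<delta> k V (f I)"
          using bspec[OF f1 I1] D1 unfolding fI by blast+
        ultimately show ?thesis by (intro conjI)
      next
        case False
        then have I2: "I \<in> D2" using I by (simp add: D2_def)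
        from bspec[OF f2 this] obtain S t where S: "S \<subseteq> I" "card S \<le> k * t"
          "family_weight p V (f2 I) \<le> (1 - \<delta>) ^ t * family_weight p V D2" "\<And>S'. S \<subseteq> S' \<Longrightarrow> S' \<subseteq> I \<Longrightarrow> f2 S' = f2 I" by blast
        have fI: "f I = f2 I" using False by (simp add: f_def)
        have "(1 - \<delta>) ^ t * family_weight p V D2 \<le> (1 - \<delta>) ^ t * family_weight p V D"
          using D2 less.prems(1) \<delta> p V by (intro mult_left_mono family_weight_mono) auto
        then have "family_weight p V (f I) \<le> (1 - \<delta>) ^ t * family_weight p V D" using S(3) fI by simp
        \<comment> \<open>No subset of \<open>I\<close> contains \<open>L\<close>, so every
          \<open>S'\<close> in the range gets the same negative answer, and nothing is added to the
          fingerprint.\<close>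
        moreover have "f S' = f I" if "S \<subseteq> S'" "S' \<subseteq> I" for S'
          using S(4)[OF that] False that(2) by (auto simp: f_def)
        ultimately have "\<exists>S\<subseteq>I. \<exists>t. card S \<le> k * t \<and> family_weight p V (f I) \<le> (1 - \<delta>) ^ t * family_weight p V D \<and>
          (\<forall>S'. S \<subseteq> S' \<longrightarrow> S' \<subseteq> I \<longrightarrow> f S' = f I)"
          using S(1,2) by metis
        moreover have "I \<in> f I" "f I \<subseteq> D" "down_closed (f I)" "spread p \<delta> k V (f I)"
          using bspec[OF f2 I2] D2 unfolding fI by blast+
        ultimately show ?thesis by (intro conjI)
      qed
    qed
  qed
qed

section \<open>Minimal forbidden sets\<close>

text \<open>As for independence systems, a circuit is a minimal set outside the family. The size
  limit \<open>k\<close> matches the hyperedges, which have at most \<open>k\<close>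
  elements.\<close>

definition circuits :: "nat \<Rightarrow> 'a set \<Rightarrow> 'a set set \<Rightarrow> 'a set set" where
  "circuits k V D = {M. M \<subseteq> V \<and> card M \<le> k \<and> M \<notin> D \<and> (\<forall>B. B \<subset> M \<longrightarrow> B \<in> D)}"

lemma finite_circuits: "finite V \<Longrightarrow> finite (circuits k V D)"
  by (rule finite_subset[of _ "Pow V"]) (auto simp: circuits_def)

lemma circuits_psubset: "M \<in> circuits k V D \<Longrightarrow> B \<subset> M \<Longrightarrow> B \<in> D"
  by (simp add: circuits_def)

lemma circuits_antichain: "M \<in> circuits k V D \<Longrightarrow> M' \<in> circuits k V D \<Longrightarrow> M \<subseteq> M' \<Longrightarrow> M' = M"
  unfolding circuits_def by blast

text \<open>The bound is obtained by grouping \<open>M'\<close> according to its intersection with \<open>M\<close>.\<close>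

lemma sum_power_circuits_le:
  fixes p :: real
  assumes V: "finite V" and p: "0 \<le> p" "p \<le> 1"
    and M: "M \<in> circuits k V D" and L: "L \<subset> M"
    and IH: "\<And>T. T \<noteq> {} \<Longrightarrow> T \<subset> M - L \<Longrightarrow>
      (\<Sum>M' | M' \<in> circuits k V D \<and> L \<union> T \<subseteq> M'. p ^ card (M' - (L \<union> T))) \<le> b" and b: "0 \<le> b"
  shows "(\<Sum>M' | M' \<in> circuits k V D \<and> L \<subseteq> M'. p ^ card (M' - M))
    \<le> (\<Sum>M' | M' \<in> circuits k V D \<and> L \<subseteq> M'. p ^ card (M' - L)) + 1 + 2 ^ card (M - L) * b"
proof -
  define w where "w T = (\<Sum>M' | M' \<in> circuits k V D \<and> T \<subseteq> M'. p ^ card (M' - T))" for T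
  define N where "N = {M' \<in> circuits k V D. L \<subseteq> M'}"
  have finC: "finite (circuits k V D)" by (rule finite_circuits[OF V])
  then have finN: "finite N" by (simp add: N_def)
  have fM: "finite (M - L)" using M finite_subset[OF _ V, of M] by (simp add: circuits_def)
  have "(\<Sum>M'\<in>N. p ^ card (M' - M)) = (\<Sum>T\<in>Pow (M - L). \<Sum>M' | M' \<in> N \<and> (M \<inter> M') - L = T. p ^ card (M' - M))"
    by (rule sum.group[symmetric]) (use finN fM in auto)
  also have "\<dots> \<le> (\<Sum>T\<in>Pow (M - L). w (L \<union> T))"
  proof (rule sum_mono)
    fix T assume "T \<in> Pow (M - L)"
    have "(\<Sum>M' | M' \<in> N \<and> (M \<inter> M') - L = T. p ^ card (M' - M)) =
      (\<Sum>M' | M' \<in> N \<and> (M \<inter> M') - L = T. p ^ card (M' - (L \<union> T)))"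
    proof (rule sum.cong[OF refl])
      fix M' assume "M' \<in> {M' \<in> N. M \<inter> M' - L = T}"
      then have "M' - M = M' - (L \<union> T)" using L unfolding N_def by blast
      then show "p ^ card (M' - M) = p ^ card (M' - (L \<union> T))" by simp
    qed
    also have "\<dots> \<le> w (L \<union> T)" unfolding w_def
      by (rule sum_mono2) (use finC p in \<open>auto simp: N_def\<close>)
    finally show "(\<Sum>M' | M' \<in> N \<and> (M \<inter> M') - L = T. p ^ card (M' - M)) \<le> w (L \<union> T)" .
  qed
  also have "\<dots> \<le> (\<Sum>T\<in>Pow (M - L). (if T = {} then w L else 0) + (if T = M - L then 1 else 0) + b)"
  proof (rule sum_mono)
    fix T assume T: "T \<in> Pow (M - L)"
    \<comment> \<open>The empty \<open>T\<close> gives the main term. If \<open>T = M - L\<close>,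
      then \<open>M'\<close> contains \<open>M\<close> and equals it, circuits being an antichain.
      The remaining classes are controlled by \<open>IH\<close>.\<close>
    consider "T = {}" | "T \<noteq> {}" "T = M - L" | "T \<noteq> {}" "T \<subset> M - L" using T by blast
    then show "w (L \<union> T) \<le> (if T = {} then w L else 0) + (if T = M - L then 1 else 0) + b"
    proof cases
      case 1 then show ?thesis using b by simp
    next
      case 2
      then have "L \<union> T = M" using L by blast
      moreover have "{M'. M' \<in> circuits k V D \<and> M \<subseteq> M'} = {M}"
        using circuits_antichain[OF M] M by blast
      ultimately have "w (L \<union> T) = 1" by (simp add: w_def)
      then show ?thesis using 2 b by simp
    next
      case 3
      then have "w (L \<union> T) \<le> b" using IH unfolding w_def by blast
      then show ?thesis using 3 by auto
    qed
  qed
  also have "\<dots> = w L + 1 + 2 ^ card (M - L) * b"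
    using fM by (simp add: sum.distrib card_Pow)
  finally show ?thesis unfolding N_def w_def by simp
qed

lemma sum_of_bool_swap:
  fixes g :: "'a \<Rightarrow> real"
  assumes "finite N" "finite D"
  shows "(\<Sum>A\<in>D. g A * (\<Sum>M\<in>N. of_bool (Q M A))) = (\<Sum>M\<in>N. \<Sum>A | A \<in> D \<and> Q M A. g A)"
proof -
  have "(\<Sum>A\<in>D. g A * (\<Sum>M\<in>N. of_bool (Q M A))) = (\<Sum>M\<in>N. \<Sum>A\<in>D. g A * of_bool (Q M A))"
    by (simp only: sum_distrib_left) (rule sum.swap)
  also have "\<dots> = (\<Sum>M\<in>N. \<Sum>A | A \<in> D \<and> Q M A. g A)"
    by (intro sum.cong refl sum.mono_neutral_cong_right) (use assms in auto)
  finally show ?thesis .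
qed

text \<open>Second moment method for the number \<open>X\<close> of circuits
  \<open>M \<supseteq> L\<close> with \<open>M - L\<close> inside the random set conditioned on
  \<open>D\<close>. Spreadness bounds the mean below by \<open>(1 - \<delta>) * w L\<close>, while
  \<open>X > 0\<close> has probability at most \<open>\<delta>\<close>; this forces
  \<open>w L\<close> to be small. The induction runs from large \<open>L\<close> to small
  \<open>L\<close>.\<close>

lemma circuits_degree_le:
  fixes p \<delta> :: real
  assumes V: "finite V" and D: "D \<subseteq> Pow V" "down_closed D" and p: "0 < p" "p < 1"
    and k: "2 \<le> k" and \<delta>: "\<delta> = 1 / 2 ^ (k + 1)" and sp: "spread p \<delta> k V D"
    and "L \<in> D" "L \<noteq> {}"
  shows "(\<Sum>M | M \<in> circuits k V D \<and> L \<subseteq> M. p ^ card (M - L)) \<le> 4 * \<delta>"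
  using assms(9,10)
proof (induction "card V - card L" arbitrary: L rule: less_induct)
  case less
  note LD = less.prems
  define w where "w T = (\<Sum>M | M \<in> circuits k V D \<and> T \<subseteq> M. p ^ card (M - T))" for T
  define N where "N = {M \<in> circuits k V D. L \<subseteq> M}"
  define B where "B = family_weight p V D"
  have finN: "finite N" by (simp add: N_def finite_circuits[OF V])
  have finD: "finite D" using finite_subset[OF D(1)] V by simp
  have LV: "L \<subseteq> V" using LD D by blast
  have finL: "finite L" by (rule finite_subset[OF LV V])
  have \<delta>1: "0 < \<delta>" "\<delta> \<le> 1/8" using k power_increasing[of 3 "k+1" "2::real"]
    by (simp_all add: \<delta> field_simps)
  have x0: "0 \<le> w L" unfolding w_def using p by (intro sum_nonneg) simp
  have wN: "w L = (\<Sum>M\<in>N. p ^ card (M - L))" by (simp add: w_def N_def)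
  have NM: "M \<subseteq> V" "finite M" "L \<subset> M" "M - L \<in> D" "card (M - L) < k" "card L < k" "M \<notin> D"
    if "M \<in> N" for M
  proof -
    have M: "M \<in> circuits k V D" "L \<subseteq> M" using that by (auto simp: N_def)
    show MV: "M \<subseteq> V" and MD: "M \<notin> D" using M by (auto simp: circuits_def)
    show fM: "finite M" by (rule finite_subset[OF MV V])
    show LM: "L \<subset> M" using LD M MD by blast
    have sub: "M - L \<subset> M" using LD LM by blast
    show "M - L \<in> D" by (rule circuits_psubset[OF M(1) sub])
    have "card M \<le> k" using M by (simp add: circuits_def)
    then show "card (M - L) < k" "card L < k"
      using psubset_card_mono[OF fM sub] psubset_card_mono[OF fM LM] by auto
  qed
  show ?case
  proof (cases "N = {}")
    case True
    then have "w L = 0" using wN by simp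
    then show ?thesis using \<delta>1 unfolding w_def by simp
  next
    case False
    then have cL: "card L < k" using NM(6) by blast
    have e0: "{} \<in> D" using down_closedD[OF D(2) LD(1)] by simp
    have "0 < (1 - p) ^ card V" using p by simp
    then have Bpos: "0 < B" using family_weight_bounds(1)[OF V D(1) e0, of p] p unfolding B_def by linarith
    define X :: "'a set \<Rightarrow> real" where "X A = (\<Sum>M\<in>N. of_bool (M - L \<subseteq> A))" for A
    define P where "P = {A \<in> D. \<exists>M\<in>N. M - L \<subseteq> A}"
    \<comment> \<open>As \<open>L\<close> is nonempty, \<open>M - L\<close> is a proper subset of a
      circuit. So it lies in \<open>D\<close> and has fewer than \<open>k\<close> elements, and
      \<open>spread\<close> applies to it.\<close>
    have first: "(1 - \<delta>) * w L * B \<le> (\<Sum>A\<in>D. subset_weight p V A * X A)"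
    proof -
      have "(\<Sum>A\<in>D. subset_weight p V A * X A) = (\<Sum>M\<in>N. family_weight p V {A\<in>D. M - L \<subseteq> A})"
        unfolding X_def family_weight_def by (rule sum_of_bool_swap[OF finN finD])
      also have "\<dots> \<ge> (\<Sum>M\<in>N. p ^ card (M - L) * ((1 - \<delta>) * B))"
      proof (rule sum_mono)
        fix M assume M: "M \<in> N"
        have "family_weight p V {A\<in>D. M - L \<subseteq> A} = p ^ card (M - L) * family_weight p V (link (M - L) D)"
          using NM(1)[OF M] by (intro family_weight_superset[OF V _ D(1)]) auto
        moreover have "(1 - \<delta>) * B \<le> family_weight p V (link (M - L) D)"
          using sp NM(4,5)[OF M] unfolding spread_def B_def by blast
        ultimately show "p ^ card (M - L) * ((1 - \<delta>) * B) \<le> family_weight p V {A\<in>D. M - L \<subseteq> A}"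
          using p by (simp add: mult_left_mono)
      qed
      also have "(\<Sum>M\<in>N. p ^ card (M - L) * ((1 - \<delta>) * B)) = (1 - \<delta>) * w L * B"
        unfolding wN sum_distrib_right[symmetric] by simp
      finally show ?thesis .
    qed
    have second: "(\<Sum>A\<in>D. subset_weight p V A * (X A)\<^sup>2) \<le> B * (w L * (w L + 2))"
    proof -
      have "(\<Sum>A\<in>D. subset_weight p V A * (X A)\<^sup>2) =
        (\<Sum>A\<in>D. subset_weight p V A * (\<Sum>z\<in>N \<times> N. of_bool ((fst z - L) \<union> (snd z - L) \<subseteq> A)))"
      proof (intro sum.cong refl arg_cong2[of _ _ _ _ "(*)"])
        fix A
        show "(X A)\<^sup>2 = (\<Sum>z\<in>N \<times> N. of_bool ((fst z - L) \<union> (snd z - L) \<subseteq> A))"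
          unfolding X_def power2_eq_square sum_product sum.cartesian_product
          by (intro sum.cong refl) auto
      qed
      also have "\<dots> = (\<Sum>z\<in>N \<times> N. family_weight p V {A\<in>D. (fst z - L) \<union> (snd z - L) \<subseteq> A})"
        unfolding family_weight_def by (rule sum_of_bool_swap) (use finN finD in auto)
      also have "\<dots> \<le> (\<Sum>z\<in>N \<times> N. p ^ card ((fst z - L) \<union> (snd z - L)) * B)"
      proof (rule sum_mono)
        fix z assume "z \<in> N \<times> N"
        then have z: "fst z \<in> N" "snd z \<in> N" by auto
        let ?F = "(fst z - L) \<union> (snd z - L)"
        have FV: "?F \<subseteq> V" using NM(1)[OF z(1)] NM(1)[OF z(2)] by blast
        \<comment> \<open>Conditioning on a down-closed family cannot make it likelier that the
          random set contains \<open>?F\<close>.\<close>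
        have "family_weight p V (link ?F D) \<le> B" unfolding B_def
          using p by (intro family_weight_mono[OF V link_subset[OF D(2)] D(1)]) auto
        then show "family_weight p V {A\<in>D. ?F \<subseteq> A} \<le> p ^ card ?F * B"
          unfolding family_weight_superset[OF V FV D(1)] using p by (intro mult_left_mono) auto
      qed
      also have "\<dots> = (\<Sum>M\<in>N. \<Sum>M'\<in>N. p ^ card ((M - L) \<union> (M' - L)) * B)"
        by (simp add: sum.cartesian_product split_def)
      also have "\<dots> = (\<Sum>M\<in>N. p ^ card (M - L) * B * (\<Sum>M'\<in>N. p ^ card (M' - M)))"
        unfolding sum_distrib_left
      proof (intro sum.cong refl)
        fix M M' assume M: "M \<in> N" "M' \<in> N"
        have "(M - L) \<union> (M' - L) = (M - L) \<union> (M' - M)" using NM(3)[OF M(1)] by blast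
        moreover have "card ((M - L) \<union> (M' - M)) = card (M - L) + card (M' - M)"
          using NM(2)[OF M(1)] NM(2)[OF M(2)] by (intro card_Un_disjoint) auto
        ultimately have "card ((M - L) \<union> (M' - L)) = card (M - L) + card (M' - M)" by simp
        then show "p ^ card ((M - L) \<union> (M' - L)) * B = p ^ card (M - L) * B * p ^ card (M' - M)"
          by (simp add: power_add mult_ac)
      qed
      also have "\<dots> \<le> (\<Sum>M\<in>N. p ^ card (M - L) * B * (w L + 2))"
      proof (intro sum_mono mult_left_mono)
        fix M assume M: "M \<in> N"
        have MC: "M \<in> circuits k V D" using M by (simp add: N_def)
        have "(\<Sum>M'\<in>N. p ^ card (M' - M)) \<le> w L + 1 + 2 ^ card (M - L) * (4 * \<delta>)"
          unfolding N_def w_def Collect_conj_eq[symmetric]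
        proof (rule sum_power_circuits_le[OF V _ _ MC NM(3)[OF M]])
          fix T assume T: "T \<noteq> {}" "T \<subset> M - L"
          have LT: "L \<union> T \<subset> M" using T NM(3)[OF M] by blast
          have LTD: "L \<union> T \<in> D" by (rule circuits_psubset[OF MC LT])
          have "L \<union> T \<subseteq> V" using LT NM(1)[OF M] by blast
          then have fLT: "finite (L \<union> T)" "card (L \<union> T) \<le> card V" using finite_subset[OF _ V] card_mono[OF V] by auto
          have "L \<subset> L \<union> T" using T by blast
          then have "card L < card (L \<union> T)" by (rule psubset_card_mono[OF fLT(1)])
          then have "card V - card (L \<union> T) < card V - card L" using fLT(2) by linarith
          from less.hyps[OF this LTD] T(1)
          show "(\<Sum>M' | M' \<in> circuits k V D \<and> L \<union> T \<subseteq> M'. p ^ card (M' - (L \<union> T))) \<le> 4 * \<delta>" by simp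
        qed (use p \<delta>1 in auto)
        moreover have "2 ^ card (M - L) \<le> (2::real) ^ (k - 1)" using NM(5)[OF M] by (intro power_increasing) auto
        \<comment> \<open>The value of \<open>\<delta>\<close> is chosen for this identity: all
          partial overlaps together contribute at most 1, and the term \<open>M' = M\<close>
          contributes another 1.\<close>
        moreover have "(2::real) ^ (k - 1) * (4 * \<delta>) = 1"
        proof -
          have "(2::real) ^ (k + 1) = 2 ^ (k - 1) * 4" using k by (cases k) auto
          then show ?thesis unfolding \<delta> by simp
        qed
        ultimately show "(\<Sum>M'\<in>N. p ^ card (M' - M)) \<le> w L + 2"
          using \<delta>1 mult_right_mono[of "2 ^ card (M - L)" "(2::real) ^ (k - 1)" "4 * \<delta>"] by linarith
      qed (use p Bpos in auto)
      also have "\<dots> = B * (w L * (w L + 2))"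
        unfolding sum_distrib_right[symmetric] wN[symmetric] by simp
      finally show ?thesis .
    qed
    \<comment> \<open>A set \<open>A\<close> in the link of \<open>L\<close> contains no
      \<open>M - L\<close> with \<open>M \<in> N\<close>, since otherwise
      \<open>M \<subseteq> A \<union> L\<close> would belong to \<open>D\<close>. As the link has
      almost the full weight of \<open>D\<close>, little is left for \<open>P\<close>.\<close>
    have third: "family_weight p V P \<le> \<delta> * B"
    proof -
      have "P \<inter> link L D = {}"
      proof (rule equals0I)
        fix A assume "A \<in> P \<inter> link L D"
        then obtain M where M: "M \<in> N" "M - L \<subseteq> A" "A \<union> L \<in> D" unfolding P_def link_def by blast
        then have "M \<subseteq> A \<union> L" by blast
        then have "M \<in> D" by (rule down_closedD[OF D(2) M(3)])
        then show False using NM(7)[OF M(1)] by simp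
      qed
      then have "family_weight p V P + family_weight p V (link L D) = family_weight p V (P \<union> link L D)"
        unfolding family_weight_def using finD finite_subset[OF link_subset[OF D(2)] finD]
        by (intro sum.union_disjoint[symmetric]) (auto simp: P_def)
      also have "\<dots> \<le> B" unfolding B_def
        using link_subset[OF D(2)] p by (intro family_weight_mono[OF V _ D(1)]) (auto simp: P_def)
      finally have "family_weight p V P + family_weight p V (link L D) \<le> B" .
      moreover have "(1 - \<delta>) * B \<le> family_weight p V (link L D)"
        using sp LD(1) cL unfolding spread_def B_def by blast
      ultimately show ?thesis by (simp add: algebra_simps)
    qed
    \<comment> \<open>\<open>X\<close> vanishes on \<open>D\<close> outside \<open>P\<close>, so the
      Cauchy-Schwarz inequality needs only the second moment of \<open>X\<close> and the weight of
      \<open>P\<close>.\<close>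
    have CS: "(\<Sum>A\<in>D. subset_weight p V A * X A)\<^sup>2 \<le> (\<Sum>A\<in>D. subset_weight p V A * (X A)\<^sup>2) * family_weight p V P"
    proof -
      have weight0: "0 \<le> subset_weight p V A" for A using p by (intro subset_weight_nonneg) auto
      have "(\<Sum>A\<in>D. subset_weight p V A * X A) = (\<Sum>A\<in>D. (sqrt (subset_weight p V A) * X A) * (sqrt (subset_weight p V A) * of_bool (A \<in> P)))"
      proof (intro sum.cong refl)
        fix A assume A: "A \<in> D"
        have "A \<notin> P \<Longrightarrow> X A = 0" using A unfolding X_def P_def by (intro sum.neutral) auto
        then show "subset_weight p V A * X A = (sqrt (subset_weight p V A) * X A) * (sqrt (subset_weight p V A) * of_bool (A \<in> P))"
          using weight0[of A] by (cases "A \<in> P") auto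
      qed
      also have "\<dots>\<^sup>2 \<le> (\<Sum>A\<in>D. (sqrt (subset_weight p V A) * X A)\<^sup>2) * (\<Sum>A\<in>D. (sqrt (subset_weight p V A) * of_bool (A \<in> P))\<^sup>2)"
        by (rule Cauchy_Schwarz_ineq_sum)
      also have "(\<Sum>A\<in>D. (sqrt (subset_weight p V A) * X A)\<^sup>2) = (\<Sum>A\<in>D. subset_weight p V A * (X A)\<^sup>2)"
        using weight0 by (simp add: power_mult_distrib)
      also have "(\<Sum>A\<in>D. (sqrt (subset_weight p V A) * of_bool (A \<in> P))\<^sup>2) = family_weight p V P"
        unfolding family_weight_def by (rule sum.mono_neutral_cong_right) (use finD weight0 in \<open>auto simp: P_def power_mult_distrib\<close>)
      finally show ?thesis .
    qed
    have "((1 - \<delta>) * w L * B)\<^sup>2 \<le> (\<Sum>A\<in>D. subset_weight p V A * X A)\<^sup>2"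
      using first x0 Bpos \<delta>1 by (intro power_mono) auto
    also have "\<dots> \<le> (\<Sum>A\<in>D. subset_weight p V A * (X A)\<^sup>2) * family_weight p V P" by (rule CS)
    also have "\<dots> \<le> (B * (w L * (w L + 2))) * (\<delta> * B)"
      using second third x0 Bpos p subset_weight_nonneg[of p V]
      by (intro mult_mono) (auto simp: family_weight_def intro!: sum_nonneg)
    finally have "B\<^sup>2 * ((1 - \<delta>) * w L)\<^sup>2 \<le> B\<^sup>2 * (w L * (w L + 2) * \<delta>)"
      by (simp add: power2_eq_square mult_ac)
    then have main: "w L * ((1 - \<delta>)\<^sup>2 * w L) \<le> w L * ((w L + 2) * \<delta>)"
      using Bpos by (simp add: power2_eq_square mult_ac)
    show ?thesis
    proof (cases "w L = 0")
      case True then show ?thesis using \<delta>1 unfolding w_def by simp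
    next
      case False
      then have "(1 - \<delta>)\<^sup>2 * w L \<le> (w L + 2) * \<delta>" using main x0 by (simp add: mult_le_cancel_left)
      \<comment> \<open>From \<open>\<delta> \<le> 1/8\<close> follows
        \<open>3 * \<delta> \<le> 1/2\<close>. The term \<open>\<delta> * w L\<close> then cancels
        on both sides and leaves \<open>w L / 2 \<le> 2 * \<delta>\<close>.\<close>
      moreover have "(1/2 + \<delta>) * w L \<le> (1 - \<delta>)\<^sup>2 * w L"
      proof (rule mult_right_mono[OF _ x0])
        have "(1 - \<delta>)\<^sup>2 = 1 - 2 * \<delta> + \<delta>\<^sup>2" by (simp add: power2_eq_square algebra_simps)
        then show "1/2 + \<delta> \<le> (1 - \<delta>)\<^sup>2" using \<delta>1 zero_le_power2[of \<delta>] by linarith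
      qed
      ultimately have "w L \<le> 4 * \<delta>" by (simp add: algebra_simps)
      then show ?thesis unfolding w_def .
    qed
  qed
qed

section \<open>Containers\<close>

text \<open>\<open>deg\<close> is a codegree condition. A hyperedge inside the container includes a
  circuit with at least two elements, since no vertex of the container is forbidden on its own. Few
  hyperedges include a given circuit, and \<open>circuits_degree_le\<close> for singletons bounds
  the weighted number of circuits.\<close>

theorem hypergraph_containers:
  fixes p \<Lambda> :: real
  assumes V: "finite V" and H: "H \<subseteq> Pow V" "\<And>E. E \<in> H \<Longrightarrow> card E \<le> k"
    and p: "0 < p" "p \<le> 1/2" and k: "2 \<le> k" and \<Lambda>: "0 \<le> \<Lambda>"
    and deg: "\<And>M. M \<subseteq> V \<Longrightarrow> 2 \<le> card M \<Longrightarrow> card M \<le> k \<Longrightarrow>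
      real (card {E\<in>H. M \<subseteq> E}) \<le> \<Lambda> * p ^ (card M - 1)"
  shows "\<exists>C. \<forall>I. I \<subseteq> V \<longrightarrow> (\<forall>E\<in>H. \<not> E \<subseteq> I) \<longrightarrow>
    (\<exists>S\<subseteq>I. real (card S) \<le> real k * 2 ^ (k + 2) * p * real (card V) \<and> I \<subseteq> C S \<and>
      real (card {E\<in>H. E \<subseteq> C S}) \<le> \<Lambda> * real (card V))"
proof -
  define \<delta> :: real where "\<delta> = 1 / 2 ^ (k + 1)"
  define D where "D = {A. A \<subseteq> V \<and> (\<forall>E\<in>H. \<not> E \<subseteq> A)}"
  have \<delta>1: "0 < \<delta>" "\<delta> \<le> 1/8" using k power_increasing[of 3 "k+1" "2::real"]
    by (simp_all add: \<delta>_def field_simps)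
  have D: "D \<subseteq> Pow V" by (auto simp: D_def)
  have "down_closed D"
  proof (rule down_closedI)
    fix A B assume "A \<in> D" "B \<subseteq> A"
    then show "B \<in> D" unfolding D_def by (blast dest: subset_trans)
  qed
  note D = D this
  have "\<exists>f. \<forall>I\<in>D. I \<in> f I \<and> f I \<subseteq> D \<and> down_closed (f I) \<and> spread p \<delta> k V (f I) \<and>
    (\<exists>S\<subseteq>I. \<exists>t. card S \<le> k * t \<and> family_weight p V (f I) \<le> (1 - \<delta>) ^ t * family_weight p V D \<and>
      (\<forall>S'. S \<subseteq> S' \<longrightarrow> S' \<subseteq> I \<longrightarrow> f S' = f I))"
    by (rule exists_spread_refinement[OF V _ _ _ _ D]) (use p \<delta>1 in auto)
  then obtain f where f: "\<forall>I\<in>D. I \<in> f I \<and> f I \<subseteq> D \<and> down_closed (f I) \<and> spread p \<delta> k V (f I) \<and>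
    (\<exists>S\<subseteq>I. \<exists>t. card S \<le> k * t \<and> family_weight p V (f I) \<le> (1 - \<delta>) ^ t * family_weight p V D \<and>
      (\<forall>S'. S \<subseteq> S' \<longrightarrow> S' \<subseteq> I \<longrightarrow> f S' = f I))" ..
  \<comment> \<open>The vertices that are not forbidden as singletons at the leaf determined by
    \<open>S\<close>.\<close>
  define C where "C S = {v. {v} \<in> f S}" for S
  have "\<exists>S\<subseteq>I. real (card S) \<le> real k * 2 ^ (k + 2) * p * real (card V) \<and> I \<subseteq> C S \<and>
      real (card {E\<in>H. E \<subseteq> C S}) \<le> \<Lambda> * real (card V)"
    if "I \<subseteq> V" "\<forall>E\<in>H. \<not> E \<subseteq> I" for I
  proof -
    have ID: "I \<in> D" using that by (simp add: D_def)
    have fI: "I \<in> f I" "f I \<subseteq> D" "down_closed (f I)" "spread p \<delta> k V (f I)" using bspec[OF f ID] by blast+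
    obtain S t where S: "S \<subseteq> I" "card S \<le> k * t" "family_weight p V (f I) \<le> (1 - \<delta>) ^ t * family_weight p V D"
      and "\<forall>S'. S \<subseteq> S' \<longrightarrow> S' \<subseteq> I \<longrightarrow> f S' = f I" using bspec[OF f ID] by blast
    then have fS: "f S = f I" by blast
    have fIV: "f I \<subseteq> Pow V" using fI(2) D(1) by blast
    have e: "{} \<in> f I" by (rule down_closedD[OF fI(3,1)]) simp
    have eD: "{} \<in> D" using e fI(2) by blast
    have ICS: "I \<subseteq> C S"
    proof
      fix v assume "v \<in> I"
      then have "{v} \<in> f I" by (intro down_closedD[OF fI(3,1)]) simp
      then show "v \<in> C S" by (simp add: C_def fS)
    qed
    \<comment> \<open>The weight of the leaf is at least \<open>(1 - p) ^ card V\<close>, the weight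
      of the empty set, and at most \<open>(1 - \<delta>) ^ t\<close>. Logarithms turn this into a
      bound on the number \<open>t\<close> of positive answers.\<close>
    have tb: "real t * \<delta> \<le> 2 * p * real (card V)"
    proof -
      have "(1 - p) ^ card V \<le> family_weight p V (f I)" using p by (intro family_weight_bounds(1)[OF V fIV e]) auto
      also have "\<dots> \<le> (1 - \<delta>) ^ t * family_weight p V D" by (rule S(3))
      also have "\<dots> \<le> (1 - \<delta>) ^ t" using family_weight_bounds(2)[OF V D(1) eD, of p] p \<delta>1
        by (intro mult_left_le) auto
      finally have "ln ((1 - p) ^ card V) \<le> ln ((1 - \<delta>) ^ t)" using p by (intro ln_mono) auto
      then have "real (card V) * ln (1 - p) \<le> real t * ln (1 - \<delta>)"
        using p \<delta>1 by (simp add: ln_realpow)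
      also have "\<dots> \<le> real t * (- \<delta>)" using \<delta>1 ln_le_minus_one[of "1 - \<delta>"]
        by (intro mult_left_mono) auto
      finally have 1: "real t * \<delta> \<le> real (card V) * (- ln (1 - p))" by simp
      have "p\<^sup>2 \<le> p / 2" using p by (simp add: power2_eq_square)
      then have "- ln (1 - p) \<le> 2 * p" using ln_one_minus_pos_lower_bound[of p] p by linarith
      then have "real (card V) * (- ln (1 - p)) \<le> real (card V) * (2 * p)" by (rule mult_left_mono) simp
      with 1 show ?thesis by (simp add: mult_ac)
    qed
    have cS: "real (card S) \<le> real k * 2 ^ (k + 2) * p * real (card V)"
    proof -
      have "real (card S) \<le> real k * real t" using S(2) by (metis of_nat_le_iff of_nat_mult)
      also have "real t = (real t * \<delta>) * 2 ^ (k + 1)" by (simp add: \<delta>_def)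
      also have "real k * (real t * \<delta> * 2 ^ (k + 1)) \<le> real k * (2 * p * real (card V) * 2 ^ (k + 1))"
        using tb by (intro mult_left_mono mult_right_mono) auto
      finally show ?thesis by (simp add: mult_ac)
    qed
    define K where "K = {M \<in> circuits k V (f I). M \<subseteq> C S \<and> 2 \<le> card M}"
    have CV: "C S \<subseteq> V" using fIV by (auto simp: C_def fS)
    have finC: "finite (C S)" by (rule finite_subset[OF CV V])
    have finK: "finite K" by (simp add: K_def finite_circuits[OF V])
    have finH: "finite H" using finite_subset[OF H(1)] V by simp
    have finM: "finite M" if "M \<subseteq> V" for M by (rule finite_subset[OF that V])
    have cover: "{E\<in>H. E \<subseteq> C S} \<subseteq> (\<Union>M\<in>K. {E\<in>H. M \<subseteq> E})"
    proof
      fix E assume "E \<in> {E\<in>H. E \<subseteq> C S}"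
      then have E: "E \<in> H" "E \<subseteq> C S" by auto
      have EV: "E \<subseteq> V" using E H by blast
      have "E \<notin> f I" using E fI(2) unfolding D_def by blast
      then have ne: "{M. M \<subseteq> E \<and> M \<notin> f I} \<noteq> {}" by blast
      have "finite {M. M \<subseteq> E \<and> M \<notin> f I}" using finM[OF EV] by simp
      from finite_has_minimal[OF this ne] obtain M where M': "M \<in> {M. M \<subseteq> E \<and> M \<notin> f I}"
        and min': "\<forall>b\<in>{M. M \<subseteq> E \<and> M \<notin> f I}. b \<subseteq> M \<longrightarrow> M = b" by (rule bexE)
      from M' have M: "M \<subseteq> E" "M \<notin> f I" by simp_all
      have min: "M' = M" if "M' \<subseteq> E" "M' \<notin> f I" "M' \<subseteq> M" for M'
        using bspec[OF min', of M'] that by simp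
      have MV: "M \<subseteq> V" using M EV by blast
      have "card M \<le> k" using card_mono[OF finM[OF EV] M(1)] H(2)[OF E(1)] by simp
      moreover have "B \<in> f I" if "B \<subset> M" for B using min[of B] that M(1) by blast
      ultimately have MC: "M \<in> circuits k V (f I)" using M MV by (simp add: circuits_def)
      have "card M \<noteq> 0" using M e finM[OF MV] by auto
      moreover have "card M \<noteq> 1"
      proof
        assume "card M = 1"
        then obtain v where v: "M = {v}" by (rule card_1_singletonE)
        then have "v \<in> C S" using M E by blast
        then show False using M(2) v by (simp add: C_def fS)
      qed
      ultimately have "2 \<le> card M" by linarith
      then have "M \<in> K" using MC M E by (auto simp: K_def)
      then show "E \<in> (\<Union>M\<in>K. {E\<in>H. M \<subseteq> E})" using E M by blast
    qed
    have KS: "M \<subseteq> V" "2 \<le> card M" "card M \<le> k" "M \<subseteq> C S" if "M \<in> K" for M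
      using that by (auto simp: K_def circuits_def)
    have "real (card {E\<in>H. E \<subseteq> C S}) \<le> real (card (\<Union>M\<in>K. {E\<in>H. M \<subseteq> E}))"
      using cover finK finH by (intro of_nat_mono card_mono) auto
    also have "\<dots> \<le> (\<Sum>M\<in>K. real (card {E\<in>H. M \<subseteq> E}))"
      unfolding of_nat_sum[symmetric] of_nat_le_iff by (rule card_UN_le[OF finK])
    also have "\<dots> \<le> (\<Sum>M\<in>K. \<Lambda> * p ^ (card M - 1))"
      by (intro sum_mono deg KS)
    also have "\<dots> = \<Lambda> * (\<Sum>M\<in>K. p ^ (card M - 1))" by (simp add: sum_distrib_left)
    \<comment> \<open>Counting each circuit once for each of its elements turns the sum into a sum
      of degrees of single vertices.\<close>
    also have "(\<Sum>M\<in>K. p ^ (card M - 1)) \<le> (\<Sum>M\<in>K. \<Sum>v | v \<in> C S \<and> v \<in> M. p ^ card (M - {v}))"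
    proof (rule sum_mono)
      fix M assume M: "M \<in> K"
      have eq: "{v \<in> C S. v \<in> M} = M" using KS(4)[OF M] by blast
      have "(\<Sum>v\<in>M. p ^ card (M - {v})) = real (card M) * p ^ (card M - 1)"
        using finM[OF KS(1)[OF M]] by simp
      moreover have "1 * p ^ (card M - 1) \<le> real (card M) * p ^ (card M - 1)"
        using KS(2)[OF M] p by (intro mult_right_mono) auto
      ultimately show "p ^ (card M - 1) \<le> (\<Sum>v | v \<in> C S \<and> v \<in> M. p ^ card (M - {v}))" unfolding eq by simp
    qed
    also have "\<dots> = (\<Sum>v\<in>C S. \<Sum>M | M \<in> K \<and> v \<in> M. p ^ card (M - {v}))"
      by (rule sum.swap_restrict[OF finK finC])
    also have "\<dots> \<le> (\<Sum>v\<in>C S. 1)"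
    proof (rule sum_mono)
      fix v assume "v \<in> C S"
      then have v: "{v} \<in> f I" by (simp add: C_def fS)
      have "(\<Sum>M | M \<in> K \<and> v \<in> M. p ^ card (M - {v})) \<le>
        (\<Sum>M | M \<in> circuits k V (f I) \<and> {v} \<subseteq> M. p ^ card (M - {v}))"
        by (rule sum_mono2) (use finite_circuits[OF V] p in \<open>auto simp: K_def\<close>)
      also have "\<dots> \<le> 4 * \<delta>"
        by (rule circuits_degree_le[OF V fIV fI(3) p(1) _ k \<delta>_def fI(4) v]) (use p in auto)
      finally show "(\<Sum>M | M \<in> K \<and> v \<in> M. p ^ card (M - {v})) \<le> 1" using \<delta>1 by linarith
    qed
    also have "\<dots> \<le> real (card V)" using card_mono[OF V CV] by simp
    finally have "real (card {E\<in>H. E \<subseteq> C S}) \<le> \<Lambda> * real (card V)"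
      using \<Lambda> by (simp add: mult_left_mono)
    then show ?thesis using S(1) cS ICS by blast
  qed
  then show ?thesis by blast
qed

section \<open>Copies of cycles\<close>

lemma edges_cycle_graph: "edges (cycle_graph k) = (\<lambda>i. {i, Suc i mod k}) ` {..<k}"
  by (auto simp: cycle_graph_def)

lemma verts_cycle_graph: "verts (cycle_graph k) = {..<k}"
  by (simp add: cycle_graph_def)

lemma verts_complete_graph: "verts (complete_graph n) = {..<n}"
  and edges_complete_graph: "edges (complete_graph n) = nsets {..<n} 2"
  by (simp_all add: complete_graph_def)

text \<open>A copy is identified with its edge set. The copies thus form a hypergraph on the pairs
  of \<open>A\<close>, whose independent sets are the edge sets without a
  \<open>k\<close>-cycle.\<close>

definition cycle_copies :: "nat \<Rightarrow> 'a set \<Rightarrow> 'a set set set" where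
  "cycle_copies k A = {(`) f ` edges (cycle_graph k) | f. inj_on f {..<k} \<and> f ` {..<k} \<subseteq> A}"

lemma image_edges_cycle_graph:
  "(`) f ` edges (cycle_graph k) = (\<lambda>i. {f i, f (Suc i mod k)}) ` {..<k}"
  by (simp add: edges_cycle_graph image_image)

lemma inj_on_cycle_edges:
  assumes "3 \<le> k" "inj_on f {..<k}"
  shows "inj_on (\<lambda>i. {f i, f (Suc i mod k)}) {..<k}"
proof (rule inj_onI)
  fix i j assume ij: "i \<in> {..<k}" "j \<in> {..<k}" and e: "{f i, f (Suc i mod k)} = {f j, f (Suc j mod k)}"
  have lt: "i < k" "j < k" "Suc i mod k < k" "Suc j mod k < k" using ij assms(1) by auto
  have inj: "f x = f y \<longleftrightarrow> x = y" if "x < k" "y < k" for x y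
    using assms(2) that by (auto simp: inj_on_def)
  from e have "i = j \<or> (i = Suc j mod k \<and> Suc i mod k = j)"
    using lt by (auto simp: doubleton_eq_iff inj)
  \<comment> \<open>Two indices that are cyclic successors of each other would force a cycle of
    length at most 2.\<close>
  moreover have False if "i = Suc j mod k" "Suc i mod k = j"
    using that lt assms(1) by (cases "Suc j = k"; cases "Suc i = k") auto
  ultimately show "i = j" by blast
qed

lemma Suc_mod_neq: "3 \<le> k \<Longrightarrow> i < k \<Longrightarrow> Suc i mod k \<noteq> i"
  by (cases "Suc i = k") auto

lemma cycle_copy_cases:
  assumes "E \<in> cycle_copies k A" "3 \<le> k"
  obtains f where "inj_on f {..<k}" "f ` {..<k} \<subseteq> A" "E = (\<lambda>i. {f i, f (Suc i mod k)}) ` {..<k}"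
    "\<Union>E = f ` {..<k}"
proof -
  obtain f where f: "inj_on f {..<k}" "f ` {..<k} \<subseteq> A" "E = (\<lambda>i. {f i, f (Suc i mod k)}) ` {..<k}"
    using assms unfolding cycle_copies_def image_edges_cycle_graph by blast
  have "\<Union>E = f ` {..<k}" unfolding f(3) using assms(2) by auto
  then show ?thesis using f that by blast
qed

lemma cycle_copy_facts:
  assumes E: "E \<in> cycle_copies k A" and k: "3 \<le> k"
  shows "card E = k" "E \<subseteq> nsets A 2" "card (\<Union>E) = k" "\<Union>E \<subseteq> A" "finite E"
proof -
  obtain f where f: "inj_on f {..<k}" "f ` {..<k} \<subseteq> A" "E = (\<lambda>i. {f i, f (Suc i mod k)}) ` {..<k}"
    "\<Union>E = f ` {..<k}" by (rule cycle_copy_cases[OF E k])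
  show "card E = k" unfolding f(3) using card_image[OF inj_on_cycle_edges[OF k f(1)]] by simp
  show "card (\<Union>E) = k" unfolding f(4) using card_image[OF f(1)] by simp
  show "\<Union>E \<subseteq> A" using f by simp
  show "finite E" unfolding f(3) by simp
  show "E \<subseteq> nsets A 2"
  proof
    fix e assume "e \<in> E"
    then obtain i where i: "i < k" "e = {f i, f (Suc i mod k)}" using f(3) by auto
    have "f i \<noteq> f (Suc i mod k)" using inj_onD[OF f(1), of i "Suc i mod k"] Suc_mod_neq[OF k i(1)] i(1) k by auto
    moreover have "f i \<in> A" "f (Suc i mod k) \<in> A" using f(2) i(1) k by auto
    ultimately show "e \<in> nsets A 2" using i(2) by simp
  qed
qed

lemma cyclic_successor_escapes:
  assumes "A \<subset> {..<k}" "A \<noteq> {}"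
  shows "\<exists>i\<in>A. Suc i mod k \<notin> A"
proof (rule ccontr)
  assume "\<not> ?thesis"
  then have step: "\<And>i. i \<in> A \<Longrightarrow> Suc i mod k \<in> A" by blast
  obtain a where a: "a \<in> A" using assms by blast
  then have ak: "a < k" using assms by blast
  have all: "(a + j) mod k \<in> A" for j
  proof (induction j)
    case 0 then show ?case using a ak by simp
  next
    case (Suc j) then show ?case using step[OF Suc] by (simp add: mod_Suc_eq)
  qed
  have "b \<in> A" if "b < k" for b
  proof -
    \<comment> \<open>Adding \<open>k\<close> before subtracting \<open>a\<close> keeps the
      subtraction of naturals exact even when \<open>b < a\<close>.\<close>
    have "a + (b + k - a) = b + k" using ak by simp
    then show ?thesis using all[of "b + k - a"] that by simp
  qed
  then show False using assms(1) by auto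
qed

text \<open>A proper part of a cycle consists of paths. The initial vertices of its edges are
  distinct, and the endpoint of one of the paths is a further vertex.\<close>

lemma card_Union_cycle_part:
  assumes E: "E \<in> cycle_copies k A" and k: "3 \<le> k" and M: "M \<subset> E" "M \<noteq> {}"
  shows "card M + 1 \<le> card (\<Union>M)"
proof -
  obtain f where f: "inj_on f {..<k}" "f ` {..<k} \<subseteq> A" "E = (\<lambda>i. {f i, f (Suc i mod k)}) ` {..<k}"
    by (rule cycle_copy_cases[OF E k])
  define g where "g i = {f i, f (Suc i mod k)}" for i
  have gE: "E = g ` {..<k}" by (simp add: f(3) g_def[abs_def])
  define B where "B = {i. i < k \<and> g i \<in> M}"
  have MB: "M = g ` B" using M(1) gE unfolding B_def by auto
  have gi: "inj_on g {..<k}" unfolding g_def by (rule inj_on_cycle_edges[OF k f(1)])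
  have Bk: "B \<subseteq> {..<k}" by (auto simp: B_def)
  have fB: "finite B" using finite_subset[OF Bk] by simp
  have "B \<noteq> {..<k}" using MB gE M(1) by blast
  then have "B \<subset> {..<k}" using Bk by blast
  moreover have "B \<noteq> {}" using MB M(2) by blast
  ultimately obtain i where i: "i \<in> B" "Suc i mod k \<notin> B" using cyclic_successor_escapes by blast
  have sub: "insert (Suc i mod k) B \<subseteq> {..<k}" using Bk k by auto
  have "card M + 1 = card (insert (Suc i mod k) B)"
    using fB i(2) card_image[OF inj_on_subset[OF gi Bk]] MB by simp
  also have "\<dots> = card (f ` insert (Suc i mod k) B)"
    using card_image[OF inj_on_subset[OF f(1) sub]] by simp
  also have "\<dots> \<le> card (\<Union>M)"
  proof (rule card_mono)
    show "finite (\<Union>M)" unfolding MB g_def using fB by auto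
    show "f ` insert (Suc i mod k) B \<subseteq> \<Union>M" unfolding MB g_def using i(1) by auto
  qed
  finally show ?thesis .
qed

section \<open>Counting the copies that contain given edges\<close>

lemma card_supersets_le_choose:
  assumes "finite A" "W \<subseteq> A"
  shows "card {X. W \<subseteq> X \<and> X \<subseteq> A \<and> card X = k} \<le> (card A - card W) choose (k - card W)"
proof -
  have fW: "finite W" by (rule finite_subset[OF assms(2,1)])
  have "{X. W \<subseteq> X \<and> X \<subseteq> A \<and> card X = k} \<subseteq> (\<union>) W ` {Y. Y \<subseteq> A - W \<and> card Y = k - card W}"
  proof
    fix X assume "X \<in> {X. W \<subseteq> X \<and> X \<subseteq> A \<and> card X = k}"
    then have X: "W \<subseteq> X" "X \<subseteq> A" "card X = k" by auto
    then have "X = W \<union> (X - W)" "X - W \<subseteq> A - W" "card (X - W) = k - card W"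
      using card_Diff_subset[OF fW X(1)] by auto
    then show "X \<in> (\<union>) W ` {Y. Y \<subseteq> A - W \<and> card Y = k - card W}" by blast
  qed
  moreover have fin: "finite {Y. Y \<subseteq> A - W \<and> card Y = k - card W}" using assms(1) by simp
  ultimately have "card {X. W \<subseteq> X \<and> X \<subseteq> A \<and> card X = k} \<le> card {Y. Y \<subseteq> A - W \<and> card Y = k - card W}"
    using surj_card_le by blast
  also have "\<dots> = (card A - card W) choose (k - card W)"
    using n_subsets[of "A - W"] assms card_Diff_subset[OF fW assms(2)] by simp
  finally show ?thesis .
qed

lemma card_supersets_le:
  assumes "finite A" "W \<subseteq> A"
  shows "card {X. W \<subseteq> X \<and> X \<subseteq> A \<and> card X = k} \<le> card A ^ (k - card W)"
proof -
  have "(card A - card W) choose (k - card W) \<le> (card A - card W) ^ (k - card W)"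
    by (cases "k - card W \<le> card A - card W") (simp_all add: binomial_le_pow binomial_eq_0)
  also have "\<dots> \<le> card A ^ (k - card W)" by (rule power_mono) auto
  finally show ?thesis using card_supersets_le_choose[OF assms, of k] by linarith
qed

lemma finite_cycle_copies: "finite A \<Longrightarrow> 3 \<le> k \<Longrightarrow> finite (cycle_copies k A)"
  by (rule finite_subset[of _ "Pow (nsets A 2)"])
     (use cycle_copy_facts(2) in \<open>auto simp: finite_imp_finite_nsets\<close>)

text \<open>The vertex set of such a copy contains \<open>\<Union>M\<close>, hence at least
  \<open>card M + 1\<close> prescribed vertices, and \<open>card A ^ (k - card M - 1)\<close> bounds
  the choices for the others. Each vertex set admits at most \<open>k ^ k\<close> maps.\<close>

lemma card_cycle_copies_containing:
  assumes A: "finite A" and k: "3 \<le> k" and M: "card M < k" "M \<noteq> {}" and An: "A \<noteq> {}"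
  shows "card {E \<in> cycle_copies k A. M \<subseteq> E} \<le> k ^ k * card A ^ (k - card M - 1)"
proof (cases "\<exists>E \<in> cycle_copies k A. M \<subseteq> E")
  case False
  then have "{E \<in> cycle_copies k A. M \<subseteq> E} = {}" by blast
  then show ?thesis by (simp only: card.empty)
next
  case True
  then obtain E0 where E0: "E0 \<in> cycle_copies k A" "M \<subseteq> E0" by blast
  then have "M \<subset> E0" using M(1) cycle_copy_facts(1)[OF E0(1) k] by auto
  from card_Union_cycle_part[OF E0(1) k this M(2)]
  have W: "card M + 1 \<le> card (\<Union>M)" .
  have WA: "\<Union>M \<subseteq> A" using E0(2) cycle_copy_facts(4)[OF E0(1) k] by blast
  define \<X> where "\<X> = {X. \<Union>M \<subseteq> X \<and> X \<subseteq> A \<and> card X = k}"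
  have finX: "finite \<X>" using A by (simp add: \<X>_def)
  have "{E \<in> cycle_copies k A. M \<subseteq> E} \<subseteq> (\<Union>X\<in>\<X>. (\<lambda>f. (`) f ` edges (cycle_graph k)) ` ({..<k} \<rightarrow>\<^sub>E X))"
  proof
    fix E assume "E \<in> {E \<in> cycle_copies k A. M \<subseteq> E}"
    then have E: "E \<in> cycle_copies k A" "M \<subseteq> E" by auto
    obtain f where f: "inj_on f {..<k}" "f ` {..<k} \<subseteq> A" "E = (\<lambda>i. {f i, f (Suc i mod k)}) ` {..<k}"
      "\<Union>E = f ` {..<k}" by (rule cycle_copy_cases[OF E(1) k])
    have X: "\<Union>E \<in> \<X>" unfolding \<X>_def using E(2) cycle_copy_facts(3,4)[OF E(1) k] by blast
    have "restrict f {..<k} \<in> {..<k} \<rightarrow>\<^sub>E \<Union>E" using f(4) by auto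
    moreover have "E = (`) (restrict f {..<k}) ` edges (cycle_graph k)"
      unfolding image_edges_cycle_graph f(3) using k by (intro image_cong refl) auto
    ultimately show "E \<in> (\<Union>X\<in>\<X>. (\<lambda>f. (`) f ` edges (cycle_graph k)) ` ({..<k} \<rightarrow>\<^sub>E X))"
      using X by blast
  qed
  moreover have finXX: "finite X" if "X \<in> \<X>" for X using that finite_subset[OF _ A] by (auto simp: \<X>_def)
  ultimately have "card {E \<in> cycle_copies k A. M \<subseteq> E} \<le>
      card (\<Union>X\<in>\<X>. (\<lambda>f. (`) f ` edges (cycle_graph k)) ` ({..<k} \<rightarrow>\<^sub>E X))"
    using finX by (intro card_mono) (auto intro!: finite_PiE)
  also have "\<dots> \<le> (\<Sum>X\<in>\<X>. card ((\<lambda>f. (`) f ` edges (cycle_graph k)) ` ({..<k} \<rightarrow>\<^sub>E X)))"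
    by (rule card_UN_le[OF finX])
  also have "\<dots> \<le> (\<Sum>X\<in>\<X>. k ^ k)"
  proof (rule sum_mono)
    fix X assume X: "X \<in> \<X>"
    have "card ((\<lambda>f. (`) f ` edges (cycle_graph k)) ` ({..<k} \<rightarrow>\<^sub>E X)) \<le> card ({..<k} \<rightarrow>\<^sub>E X)"
      using finXX[OF X] by (intro card_image_le finite_PiE) auto
    also have "\<dots> = k ^ k" using X by (simp add: card_PiE \<X>_def)
    finally show "card ((\<lambda>f. (`) f ` edges (cycle_graph k)) ` ({..<k} \<rightarrow>\<^sub>E X)) \<le> k ^ k" .
  qed
  also have "\<dots> = k ^ k * card \<X>" by simp
  also have "card \<X> \<le> card A ^ (k - card (\<Union>M))" unfolding \<X>_def by (rule card_supersets_le[OF A WA])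
  also have "\<dots> \<le> card A ^ (k - card M - 1)" using W An A
    by (intro power_increasing) (auto simp: Suc_leI card_gt_0_iff)
  finally show ?thesis by simp
qed

lemma card_cycle_copies_full:
  assumes k: "3 \<le> k" and M: "card M = k"
  shows "card {E \<in> cycle_copies k A. M \<subseteq> E} \<le> 1"
proof -
  have "{E \<in> cycle_copies k A. M \<subseteq> E} \<subseteq> {M}"
  proof
    fix E assume "E \<in> {E \<in> cycle_copies k A. M \<subseteq> E}"
    then have "E \<in> cycle_copies k A" "M \<subseteq> E" by auto
    then show "E \<in> {M}" using card_subset_eq[of E M] cycle_copy_facts(1,5)[of E k A] k M by auto
  qed
  from card_mono[OF _ this] show ?thesis by simp
qed

section \<open>The arrow relation and the Ramsey number in terms of edge sets\<close>

lemma is_copy_cycle_iff: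
  "is_copy f (cycle_graph k) G \<longleftrightarrow>
    inj_on f {..<k} \<and> f ` {..<k} \<subseteq> verts G \<and> (`) f ` edges (cycle_graph k) \<subseteq> edges G"
  by (auto simp: is_copy_def verts_cycle_graph)

lemma arrows_cycle_iff:
  "arrows G (cycle_graph k) r \<longleftrightarrow> (\<forall>c. (\<forall>e\<in>edges G. c e < r) \<longrightarrow>
     (\<exists>E\<in>cycle_copies k (verts G). E \<subseteq> edges G \<and> (\<exists>i<r. \<forall>e\<in>E. c e = i)))"
proof -
  have "(\<exists>f. is_copy f (cycle_graph k) G \<and> (\<exists>i<r. \<forall>e\<in>edges (cycle_graph k). c (f ` e) = i)) \<longleftrightarrow>
    (\<exists>E\<in>cycle_copies k (verts G). E \<subseteq> edges G \<and> (\<exists>i<r. \<forall>e\<in>E. c e = i))" for c :: "'a set \<Rightarrow> nat"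
  proof -
    have *: "(\<exists>E\<in>cycle_copies k (verts G). Q E) \<longleftrightarrow>
      (\<exists>f. inj_on f {..<k} \<and> f ` {..<k} \<subseteq> verts G \<and> Q ((`) f ` edges (cycle_graph k)))" for Q
      unfolding cycle_copies_def by (rule iffI) (elim bexE CollectE exE conjE, simp, metis, metis (mono_tags, lifting) mem_Collect_eq)
    show ?thesis unfolding * is_copy_cycle_iff ball_simps by (simp only: conj_assoc)
  qed
  then show ?thesis unfolding arrows_def by simp
qed

text \<open>A monochromatic complete graph on \<open>k\<close> vertices contains a
  \<open>k\<close>-cycle, so Ramsey's theorem supplies some order with the arrow property; hence the
  least one has it too.\<close>

lemma ramsey_number_arrows:
  assumes "1 \<le> r" "2 \<le> k"
  shows "arrows (complete_graph (ramsey_number (cycle_graph k) r)) (cycle_graph k) r"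
proof -
  obtain N :: nat where N: "partn_lst {..<N} (replicate r k) 2" using ramsey_full[of "replicate r k" 2] by blast
  have "arrows (complete_graph N) (cycle_graph k) r"
    unfolding arrows_cycle_iff verts_complete_graph edges_complete_graph
  proof (intro allI impI)
    fix c :: "nat set \<Rightarrow> nat" assume c: "\<forall>e\<in>nsets {..<N} 2. c e < r"
    then have "c \<in> nsets {..<N} 2 \<rightarrow> {..<length (replicate r k)}" by auto
    then obtain i where i: "i < r" "monochromatic {..<N} (replicate r k ! i) 2 c i"
      using N unfolding partn_lst_def by force
    then obtain X where X: "X \<in> nsets {..<N} k" "c ` nsets X 2 \<subseteq> {i}"
      unfolding monochromatic_def by auto
    then have Xf: "finite X" "card X = k" "X \<subseteq> {..<N}" by (auto simp: nsets_def)
    then obtain g where g: "bij_betw g {..<k} X" using ex_bij_betw_nat_finite[OF Xf(1)]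
      by (auto simp: atLeast0LessThan)
    define E where "E = (`) g ` edges (cycle_graph k)"
    have EX: "E \<in> cycle_copies k X" unfolding E_def cycle_copies_def
      using g by (auto simp: bij_betw_def)
    then have "E \<in> cycle_copies k {..<N}" using Xf(3) unfolding cycle_copies_def by blast
    moreover have EX2: "E \<subseteq> nsets X 2"
    proof
      fix e assume "e \<in> E"
      then obtain j where j: "j < k" "e = {g j, g (Suc j mod k)}"
        unfolding E_def image_edges_cycle_graph by auto
      have "Suc j mod k \<noteq> j" using j(1) assms(2) by (cases "Suc j = k") auto
      moreover have "Suc j mod k < k" using assms(2) by simp
      ultimately show "e \<in> nsets X 2" using j g bij_betwE[OF g]
        by (auto simp: bij_betw_def inj_on_def)
    qed
    moreover have "\<forall>e\<in>E. c e = i" using EX2 X(2) by blast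
    moreover have "nsets X 2 \<subseteq> nsets {..<N} 2" by (rule nsets_mono[OF Xf(3)])
    ultimately show "\<exists>E\<in>cycle_copies k {..<N}. E \<subseteq> nsets {..<N} 2 \<and> (\<exists>i<r. \<forall>e\<in>E. c e = i)"
      using i(1) by (intro bexI[of _ E]) blast+
  qed
  then show ?thesis unfolding ramsey_number_def by (rule LeastI)
qed

text \<open>For the second bound each pair is coloured by its smaller element. On at most
  \<open>r + 1\<close> vertices all colours are below \<open>r\<close>, every colour class is a
  star, and a star contains no cycle.\<close>

lemma ramsey_number_cycle_ge:
  assumes "1 \<le> r" "4 \<le> k"
  shows "k \<le> ramsey_number (cycle_graph k) r" (is "k \<le> ?R")
    and "r + 2 \<le> ramsey_number (cycle_graph k) r"
proof -
  have a: "\<And>c. \<forall>e\<in>nsets {..<?R} 2. c e < r \<Longrightarrow>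
     \<exists>E\<in>cycle_copies k {..<?R}. E \<subseteq> nsets {..<?R} 2 \<and> (\<exists>i<r. \<forall>e\<in>E. c e = i)"
    using ramsey_number_arrows[of r k] assms
    unfolding arrows_cycle_iff verts_complete_graph edges_complete_graph by simp
  obtain E where E: "E \<in> cycle_copies k {..<?R}" using a[of "\<lambda>_. 0"] assms by auto
  have "card (\<Union>E) = k" "\<Union>E \<subseteq> {..<?R}" using cycle_copy_facts[OF E] assms(2) by auto
  then show "k \<le> ?R" using card_mono[of "{..<?R}" "\<Union>E"] by simp
  show "r + 2 \<le> ?R"
  proof (rule ccontr)
    assume "\<not> ?thesis"
    then have R: "?R \<le> r + 1" by simp
    have "\<forall>e\<in>nsets {..<?R} 2. Min e < r"
    proof
      fix e assume "e \<in> nsets {..<?R} 2"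
      then obtain x y where e: "e = {x, y}" "x \<in> {..<?R}" "y \<in> {..<?R}" "x \<noteq> y"
        by (rule nsets2_E)
      then show "Min e < r" using R by auto
    qed
    from a[OF this] obtain E i where E: "E \<in> cycle_copies k {..<?R}" "\<forall>e\<in>E. Min e = i" by blast
    have k3: "3 \<le> k" using assms(2) by simp
    obtain f where f: "inj_on f {..<k}" "E = (\<lambda>i. {f i, f (Suc i mod k)}) ` {..<k}"
      by (rule cycle_copy_cases[OF E(1) k3])
    have "Min {f j, f (Suc j mod k)} = i" if "j < k" for j using E(2) f(2) that by blast
    \<comment> \<open>The first and the third edge of a cycle of length at least 4 are disjoint, yet
      both would contain \<open>i\<close>.\<close>
    from this[of 0] this[of 2] have "Min {f 0, f 1} = i" "Min {f 2, f 3} = i" using assms(2) by (auto simp: eval_nat_numeral)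
    then have "i \<in> {f 0, f 1}" "i \<in> {f 2, f 3}" using Min_in[of "{f 0, f 1}"] Min_in[of "{f 2, f 3}"] by auto
    then show False using inj_onD[OF f(1), of 0 2] inj_onD[OF f(1), of 0 3]
       inj_onD[OF f(1), of 1 2] inj_onD[OF f(1), of 1 3] assms(2) by auto
  qed
qed

section \<open>Supersaturation\<close>

text \<open>The classes may overlap; the least index of a class containing a pair defines a
  colouring, which is transported to the standard complete graph along a bijection.\<close>

lemma covered_clique_contains_copy:
  assumes kr: "4 \<le> k" "1 \<le> r" and X: "finite X" "card X = ramsey_number (cycle_graph k) r"
    and cov: "nsets X 2 \<subseteq> (\<Union>i<r. C i)"
  shows "\<exists>i<r. \<exists>E\<in>cycle_copies k X. E \<subseteq> C i"
proof -
  let ?R = "ramsey_number (cycle_graph k) r"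
  obtain g where g: "bij_betw g {..<?R} X"
    using ex_bij_betw_nat_finite[OF X(1)] X(2) by (auto simp: atLeast0LessThan)
  have gi: "inj_on g {..<?R}" and gX: "g ` {..<?R} = X" using g by (auto simp: bij_betw_def)
  define c where "c e = (LEAST i. g ` e \<in> C i)" for e
  have ce: "c e < r \<and> g ` e \<in> C (c e)" if e: "e \<in> nsets {..<?R} 2" for e
  proof -
    obtain x y where xy: "e = {x, y}" "x \<in> {..<?R}" "y \<in> {..<?R}" "x \<noteq> y" using e by (rule nsets2_E)
    have "g x \<in> X" "g y \<in> X" using gX xy by auto
    moreover have "g x \<noteq> g y" using inj_onD[OF gi] xy by blast
    ultimately have "g ` e \<in> nsets X 2" using xy(1) by simp
    then obtain i where i: "i < r" "g ` e \<in> C i" using cov by blast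
    have "g ` e \<in> C (c e)" unfolding c_def by (rule LeastI[of _ i]) (rule i(2))
    moreover have "c e \<le> i" unfolding c_def by (rule Least_le) (rule i(2))
    ultimately show ?thesis using i(1) by simp
  qed
  have "\<exists>E\<in>cycle_copies k {..<?R}. E \<subseteq> nsets {..<?R} 2 \<and> (\<exists>i<r. \<forall>e\<in>E. c e = i)"
    using ramsey_number_arrows[of r k] kr ce
    unfolding arrows_cycle_iff verts_complete_graph edges_complete_graph by simp
  then obtain E i where E: "E \<in> cycle_copies k {..<?R}" "E \<subseteq> nsets {..<?R} 2" and
    i: "i < r" "\<forall>e\<in>E. c e = i" by blast
  obtain f where f: "inj_on f {..<k}" "f ` {..<k} \<subseteq> {..<?R}" "E = (`) f ` edges (cycle_graph k)"
    using E(1) unfolding cycle_copies_def by blast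
  have "(`) (g \<circ> f) ` edges (cycle_graph k) \<in> cycle_copies k X"
    unfolding cycle_copies_def
  proof (rule CollectI, intro exI[of _ "g \<circ> f"] conjI refl)
    show "inj_on (g \<circ> f) {..<k}" using f gi by (intro comp_inj_on) (auto intro: inj_on_subset)
    show "(g \<circ> f) ` {..<k} \<subseteq> X" using f(2) gX by auto
  qed
  moreover have "(`) (g \<circ> f) ` edges (cycle_graph k) = (`) g ` E"
    unfolding f(3) by (simp add: image_image image_comp comp_def)
  moreover have "(`) g ` E \<subseteq> C i"
  proof
    fix e assume "e \<in> (`) g ` E"
    then obtain e' where "e' \<in> E" "e = g ` e'" by blast
    then show "e \<in> C i" using ce[of e'] E(2) i(2) by auto
  qed
  ultimately show ?thesis using i(1) by auto
qed

lemma cycle_copies_mono: "A \<subseteq> B \<Longrightarrow> cycle_copies k A \<subseteq> cycle_copies k B"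
  unfolding cycle_copies_def by blast

text \<open>Double counting of the \<open>R\<close>-subsets of \<open>A\<close>. One with all pairs
  covered contains a copy inside some \<open>C i\<close>, and by \<open>few\<close> at most half are
  of this kind. Each other one contains an uncovered pair, and a pair lies in at most
  \<open>(n - 2) choose (R - 2)\<close> of them.\<close>

lemma supersaturation:
  assumes kr: "4 \<le> k" "1 \<le> r" and R: "R = ramsey_number (cycle_graph k) r"
    and A: "finite A" "R \<le> card A"
    and few: "(\<Sum>i<r. card {E \<in> cycle_copies k A. E \<subseteq> C i}) * 2 * (R choose k) \<le> card A choose k"
  shows "card A choose 2 \<le> 2 * card (nsets A 2 - (\<Union>i<r. C i)) * (R choose 2)"
proof -
  define n where "n = card A"
  define U where "U = nsets A 2 - (\<Union>i<r. C i)"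
  define H where "H i = {E \<in> cycle_copies k A. E \<subseteq> C i}" for i
  define B where "B = {X \<in> nsets A R. nsets X 2 \<subseteq> (\<Union>i<r. C i)}"
  have k3: "3 \<le> k" using kr by simp
  have kR: "k \<le> R" "r + 2 \<le> R" using ramsey_number_cycle_ge[OF kr(2,1)] R by auto
  have Rn: "R \<le> n" using A by (simp add: n_def)
  have finR: "finite (nsets A R)" by (rule finite_imp_finite_nsets[OF A(1)])
  have finH: "finite (H i)" for i using finite_cycle_copies[OF A(1) k3] by (simp add: H_def)
  have sup: "{X \<in> nsets A R. W \<subseteq> X} = {X. W \<subseteq> X \<and> X \<subseteq> A \<and> card X = R}" for W
    using finite_subset[OF _ A(1)] by (auto simp: nsets_def)
  have cB: "card B \<le> (\<Sum>i<r. card (H i)) * ((n - k) choose (R - k))"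
  proof -
    have "B \<subseteq> (\<Union>i<r. \<Union>E\<in>H i. {X \<in> nsets A R. \<Union>E \<subseteq> X})"
    proof
      fix X assume "X \<in> B"
      then have X: "X \<in> nsets A R" "nsets X 2 \<subseteq> (\<Union>i<r. C i)" by (auto simp: B_def)
      then have X': "finite X" "card X = ramsey_number (cycle_graph k) r" "X \<subseteq> A" using R by (auto simp: nsets_def)
      from covered_clique_contains_copy[OF kr X'(1,2) X(2)]
      obtain i where i: "i < r" "\<exists>E\<in>cycle_copies k X. E \<subseteq> C i" by (elim exE conjE)
      from i(2) obtain E where E: "E \<in> cycle_copies k X" "E \<subseteq> C i" by (rule bexE)
      have "E \<in> H i" using subsetD[OF cycle_copies_mono[OF X'(3)] E(1)] E(2) by (simp add: H_def)
      moreover have "\<Union>E \<subseteq> X" by (rule cycle_copy_facts(4)[OF E(1) k3])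
      ultimately show "X \<in> (\<Union>i<r. \<Union>E\<in>H i. {X \<in> nsets A R. \<Union>E \<subseteq> X})"
        using i(1) X(1) by (intro UN_I[of i] UN_I[of E]) auto
    qed
    then have "card B \<le> card (\<Union>i<r. \<Union>E\<in>H i. {X \<in> nsets A R. \<Union>E \<subseteq> X})"
      using finH finR by (intro card_mono) auto
    also have "\<dots> \<le> (\<Sum>i<r. card (\<Union>E\<in>H i. {X \<in> nsets A R. \<Union>E \<subseteq> X}))"
      by (rule card_UN_le) simp
    also have "\<dots> \<le> (\<Sum>i<r. card (H i) * ((n - k) choose (R - k)))"
    proof (rule sum_mono)
      fix i
      have "card (\<Union>E\<in>H i. {X \<in> nsets A R. \<Union>E \<subseteq> X}) \<le> (\<Sum>E\<in>H i. card {X \<in> nsets A R. \<Union>E \<subseteq> X})"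
        by (rule card_UN_le[OF finH])
      also have "\<dots> \<le> (\<Sum>E\<in>H i. (n - k) choose (R - k))"
      proof (rule sum_mono)
        fix E assume "E \<in> H i"
        then have E: "E \<in> cycle_copies k A" by (simp add: H_def)
        show "card {X \<in> nsets A R. \<Union>E \<subseteq> X} \<le> (n - k) choose (R - k)"
          using card_supersets_le_choose[OF A(1) cycle_copy_facts(4)[OF E k3], of R]
          unfolding sup cycle_copy_facts(3)[OF E k3] n_def .
      qed
      finally show "card (\<Union>E\<in>H i. {X \<in> nsets A R. \<Union>E \<subseteq> X}) \<le> card (H i) * ((n - k) choose (R - k))" by simp
    qed
    finally show ?thesis by (simp add: sum_distrib_right)
  qed
  have "card B * 2 * (R choose k) \<le> (\<Sum>i<r. card (H i)) * ((n - k) choose (R - k)) * 2 * (R choose k)"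
    using cB by simp
  also have "\<dots> = ((\<Sum>i<r. card (H i)) * 2 * (R choose k)) * ((n - k) choose (R - k))" by (simp only: mult_ac)
  also have "\<dots> \<le> (n choose k) * ((n - k) choose (R - k))"
    using few unfolding H_def n_def by (rule mult_le_mono1)
  \<comment> \<open>Both sides count the \<open>k\<close>-sets nested in \<open>R\<close>-sets. The
    factor \<open>R choose k\<close> is positive by \<open>k \<le> R\<close> and cancels.\<close>
  also have "\<dots> = (n choose R) * (R choose k)" using choose_mult[OF kR(1) Rn] by simp
  finally have B2: "card B * 2 \<le> n choose R" using kR by (simp add: zero_less_binomial_iff)
  have cG: "card (nsets A R - B) \<le> card U * ((n - 2) choose (R - 2))"
  proof -
    have "nsets A R - B \<subseteq> (\<Union>e\<in>U. {X \<in> nsets A R. e \<subseteq> X})"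
    proof
      fix X assume X: "X \<in> nsets A R - B"
      then obtain e where e: "e \<in> nsets X 2" "e \<notin> (\<Union>i<r. C i)" unfolding B_def by blast
      have "X \<subseteq> A" using X by (auto simp: nsets_def)
      then have "e \<in> U" using e nsets_mono[of X A 2] unfolding U_def by blast
      moreover have "e \<subseteq> X" using e by (auto simp: nsets_def)
      ultimately show "X \<in> (\<Union>e\<in>U. {X \<in> nsets A R. e \<subseteq> X})" using X by blast
    qed
    moreover have finU: "finite U" unfolding U_def using finite_imp_finite_nsets[OF A(1)] by simp
    ultimately have "card (nsets A R - B) \<le> card (\<Union>e\<in>U. {X \<in> nsets A R. e \<subseteq> X})"
      using finR by (intro card_mono) auto
    also have "\<dots> \<le> (\<Sum>e\<in>U. card {X \<in> nsets A R. e \<subseteq> X})" by (rule card_UN_le[OF finU])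
    also have "\<dots> \<le> (\<Sum>e\<in>U. (n - 2) choose (R - 2))"
    proof (rule sum_mono)
      fix e assume "e \<in> U"
      then have e: "e \<subseteq> A" "card e = 2" by (auto simp: U_def nsets_def)
      show "card {X \<in> nsets A R. e \<subseteq> X} \<le> (n - 2) choose (R - 2)"
        using card_supersets_le_choose[OF A(1) e(1), of R] unfolding sup e(2) n_def .
    qed
    finally show ?thesis by simp
  qed
  have "card (nsets A R) = n choose R" by (simp add: n_def)
  moreover have "B \<subseteq> nsets A R" by (auto simp: B_def)
  ultimately have "card (nsets A R - B) = (n choose R) - card B"
    using card_Diff_subset[OF finite_subset[OF _ finR]] by metis
  then have "n choose R \<le> 2 * (card U * ((n - 2) choose (R - 2)))" using cG B2 by linarith
  then have "(n choose R) * (n choose 2) \<le> 2 * (card U * ((n - 2) choose (R - 2))) * (n choose 2)"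
    by (rule mult_le_mono1)
  also have "\<dots> = 2 * card U * ((n choose 2) * ((n - 2) choose (R - 2)))" by (simp only: mult_ac)
  also have "\<dots> = 2 * card U * ((n choose R) * (R choose 2))" using choose_mult[of 2 R n] kR kr Rn by simp
  also have "\<dots> = (n choose R) * (2 * card U * (R choose 2))" by (simp only: mult_ac)
  finally show ?thesis using Rn unfolding n_def U_def by (simp add: zero_less_binomial_iff)
qed

text \<open>\<open>\<Lambda>\<close> is fitted to whole copies: for \<open>card M = k\<close> the
  codegree bound is exactly 1. For smaller \<open>M\<close> there is room by a factor
  \<open>m ^ (card M - 1)\<close>, which absorbs \<open>k ^ k\<close> and the powers of
  \<open>a\<close>.\<close>

lemma cycle_containers:
  assumes k: "4 \<le> k" and A: "finite A" "card A = m ^ (k - 1)"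
    and a: "1 \<le> a" "2 * a \<le> m ^ (k - 2)" "k ^ k * a ^ (k - 2) \<le> m"
  shows "\<exists>C. \<forall>I. I \<subseteq> nsets A 2 \<longrightarrow> (\<forall>E\<in>cycle_copies k A. \<not> E \<subseteq> I) \<longrightarrow>
    (\<exists>S\<subseteq>I. real (card S) \<le> real k * 2 ^ (k + 2) * (real a / real m ^ (k - 2)) * real (card A choose 2) \<and>
      I \<subseteq> C S \<and> real (card {E\<in>cycle_copies k A. E \<subseteq> C S})
        \<le> real (card A) ^ (k - 2) / real a ^ (k - 1) * real (card A choose 2))"
proof -
  define n where "n = card A"
  define p where "p = real a / real m ^ (k - 2)"
  define \<Lambda> where "\<Lambda> = real n ^ (k - 2) / real a ^ (k - 1)"
  have k3: "3 \<le> k" using k by simp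
  have nm: "n = m ^ (k - 1)" by (simp add: n_def A)
  have m: "1 \<le> m" using a(1,2) k by (cases "m = 0") (auto simp: power_0_left)
  have An: "A \<noteq> {}" using A m by (metis card.empty le_numeral_extra(2) power_not_zero not_one_le_zero)
  have p: "0 < p" "p \<le> 1/2"
  proof -
    show "0 < p" using a m by (simp add: p_def)
    have "2 * real a \<le> real m ^ (k - 2)" using a(2) by (metis of_nat_le_iff of_nat_mult of_nat_numeral of_nat_power)
    then show "p \<le> 1/2" using m by (simp add: p_def field_simps)
  qed
  have deg: "real (card {E\<in>cycle_copies k A. M \<subseteq> E}) \<le> \<Lambda> * p ^ (card M - 1)"
    if M: "2 \<le> card M" "card M \<le> k" for M
  proof (cases "card M = k")
    case True
    have "real n ^ (k - 2) = (real m ^ (k - 2)) ^ (k - 1)"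
      by (simp add: nm power_mult[symmetric] mult.commute)
    then have "\<Lambda> * p ^ (card M - 1) = 1"
      using a m unfolding \<Lambda>_def p_def True by (simp add: power_divide)
    then show ?thesis using card_cycle_copies_full[OF k3 True, of A] by simp
  next
    case False
    define j where "j = card M - 1"
    define l where "l = k - card M - 1"
    have jl: "card M = j + 1" "1 \<le> j" "k = l + j + 2" using M False by (auto simp: j_def l_def)
    have "card {E\<in>cycle_copies k A. M \<subseteq> E} \<le> k ^ k * n ^ l"
      unfolding n_def l_def using card_cycle_copies_containing[OF A(1) k3 _ _ An, of M] M False by force
    then have "real (card {E\<in>cycle_copies k A. M \<subseteq> E}) \<le> real (k ^ k * n ^ l)" by (rule of_nat_mono)
    also have "\<dots> = real (k ^ k * n ^ l) * real a ^ (l + 1) * (real m ^ (l + j)) ^ j / (real a ^ (l + 1) * (real m ^ (l + j)) ^ j)"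
      using a m by simp
    also have "\<dots> \<le> real n ^ (l + j) / (real a ^ (l + 1) * (real m ^ (l + j)) ^ j)"
    proof (rule divide_right_mono)
      \<comment> \<open>Since \<open>n = m ^ (l + j + 1)\<close>, the comparison reduces to
        \<open>k ^ k * a ^ (l + 1) \<le> m ^ j\<close>, where \<open>j \<ge> 1\<close>.\<close>
      have "k ^ k * a ^ (l + 1) \<le> k ^ k * a ^ (k - 2)"
        using a(1) jl by (intro mult_left_mono power_increasing) auto
      also have "\<dots> \<le> m" by (rule a(3))
      also have "\<dots> \<le> m ^ j" using m jl(2) by (intro self_le_power) auto
      finally have 1: "k ^ k * a ^ (l + 1) \<le> m ^ j" .
      have "k ^ k * n ^ l * a ^ (l + 1) * (m ^ (l + j)) ^ j = (k ^ k * a ^ (l + 1)) * (n ^ l * (m ^ (l + j)) ^ j)"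
        by (simp only: mult_ac)
      also have "\<dots> \<le> m ^ j * (n ^ l * (m ^ (l + j)) ^ j)" using 1 by (rule mult_le_mono1)
      also have "\<dots> = n ^ l * (m ^ (l + j + 1)) ^ j" by (simp add: power_mult_distrib mult_ac)
      also have "\<dots> = n ^ (l + j)" unfolding nm jl(3) by (simp add: power_add)
      finally have "real (k ^ k * n ^ l * a ^ (l + 1) * (m ^ (l + j)) ^ j) \<le> real (n ^ (l + j))" by (rule of_nat_mono)
      then show "real (k ^ k * n ^ l) * real a ^ (l + 1) * (real m ^ (l + j)) ^ j \<le> real n ^ (l + j)" by simp
    qed simp
    also have "\<dots> = \<Lambda> * p ^ (card M - 1)"
      using a(1) m unfolding \<Lambda>_def p_def jl(1) unfolding jl(3)
      by (simp add: power_divide power_add field_simps)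
    finally show ?thesis .
  qed
  have HP: "cycle_copies k A \<subseteq> Pow (nsets A 2)"
    by (rule subsetI, rule PowI, rule cycle_copy_facts(2)[OF _ k3])
  have "\<exists>C. \<forall>I. I \<subseteq> nsets A 2 \<longrightarrow> (\<forall>E\<in>cycle_copies k A. \<not> E \<subseteq> I) \<longrightarrow>
    (\<exists>S\<subseteq>I. real (card S) \<le> real k * 2 ^ (k + 2) * p * real (card (nsets A 2)) \<and> I \<subseteq> C S \<and>
      real (card {E\<in>cycle_copies k A. E \<subseteq> C S}) \<le> \<Lambda> * real (card (nsets A 2)))"
    by (rule hypergraph_containers)
       (use p deg k3 HP cycle_copy_facts(1)[OF _ k3, where A = A] finite_imp_finite_nsets[OF A(1)] in \<open>auto simp: \<Lambda>_def\<close>)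
  then show ?thesis unfolding card_nsets p_def \<Lambda>_def n_def .
qed

section \<open>Random graphs\<close>

lemma exists_less_one_of_expectation:
  fixes Y :: "'a set \<Rightarrow> real"
  assumes V: "finite V" and p: "0 \<le> p" "p \<le> 1" and Y: "(\<Sum>A\<in>Pow V. subset_weight p V A * Y A) < 1"
  shows "\<exists>A\<subseteq>V. Y A < 1"
proof (rule ccontr)
  assume "\<not> ?thesis"
  then have "1 \<le> Y A" if "A \<in> Pow V" for A using that by (meson PowD not_less)
  then have "(\<Sum>A\<in>Pow V. subset_weight p V A * 1) \<le> (\<Sum>A\<in>Pow V. subset_weight p V A * Y A)"
    using p by (intro sum_mono mult_left_mono subset_weight_nonneg) auto
  then show False using Y sum_subset_weight[OF V, of p] by simp
qed

lemma sum_subset_weight_containing: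
  assumes "finite V" "E \<subseteq> V"
  shows "(\<Sum>A | A \<in> Pow V \<and> E \<subseteq> A. subset_weight p V A) = p ^ card E"
  using sum_subset_weight_superset[OF assms, of p "\<lambda>_. True"] sum_subset_weight[OF assms(1), of p]
  unfolding Pow_def mem_Collect_eq by simp

text \<open>Both demands are met by one set because \<open>Y1 / z + Y2\<close> has expectation below
  1. \<open>Y1\<close> counts the members of \<open>\<S>\<close> inside \<open>G\<close>; the
  summand of \<open>Y2\<close> for \<open>s\<close> is at least 1 as soon as
  \<open>card (G \<inter> D s) \<le> z\<close>, which is Markov's inequality for an exponential
  moment.\<close>

lemma exists_sparse_hitting_set:
  fixes q :: real
  assumes V: "finite V" and q: "0 \<le> q" "q \<le> 1" and z: "0 < z"
    and S: "finite \<S>" "\<And>E. E \<in> \<S> \<Longrightarrow> E \<subseteq> V" "(\<Sum>E\<in>\<S>. q ^ card E) \<le> real z / 2"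
    and T: "finite T" "\<And>s. s \<in> T \<Longrightarrow> D s \<subseteq> V" "(\<Sum>s\<in>T. 2 ^ z * (1 - q / 2) ^ card (D s)) < 1/2"
  shows "\<exists>G\<subseteq>V. card {E\<in>\<S>. E \<subseteq> G} < z \<and> (\<forall>s\<in>T. z < card (G \<inter> D s))"
proof -
  define Y1 :: "'a set \<Rightarrow> real" where "Y1 G = (\<Sum>E\<in>\<S>. of_bool (E \<subseteq> G))" for G
  define Y2 :: "'a set \<Rightarrow> real" where "Y2 G = (\<Sum>s\<in>T. 2 ^ z * (1/2) ^ card (G \<inter> D s))" for G
  have finP: "finite (Pow V)" using V by simp
  have "(\<Sum>A\<in>Pow V. subset_weight q V A * Y1 A) = (\<Sum>E\<in>\<S>. q ^ card E)"
    unfolding Y1_def sum_of_bool_swap[OF S(1) finP]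
    by (intro sum.cong refl sum_subset_weight_containing[OF V] S(2))
  then have e1: "(\<Sum>A\<in>Pow V. subset_weight q V A * Y1 A) \<le> real z / 2" using S(3) by simp
  have "(\<Sum>A\<in>Pow V. subset_weight q V A * Y2 A) = (\<Sum>A\<in>Pow V. \<Sum>s\<in>T. 2 ^ z * (subset_weight q V A * (1/2) ^ card (A \<inter> D s)))"
    unfolding Y2_def by (simp add: sum_distrib_left mult_ac)
  also have "\<dots> = (\<Sum>s\<in>T. 2 ^ z * (\<Sum>A\<in>Pow V. subset_weight q V A * (1/2) ^ card (A \<inter> D s)))"
    by (subst sum.swap) (simp add: sum_distrib_left)
  also have "\<dots> = (\<Sum>s\<in>T. 2 ^ z * (1 - q / 2) ^ card (D s))"
  proof (intro sum.cong refl arg_cong2[of _ _ _ _ "(*)"])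
    fix s assume "s \<in> T"
    then have "V \<inter> D s = D s" using T(2) by blast
    then show "(\<Sum>A\<in>Pow V. subset_weight q V A * (1/2) ^ card (A \<inter> D s)) = (1 - q / 2) ^ card (D s)"
      using sum_subset_weight_power_card_Int[OF V, of q "1/2" "D s"] by simp
  qed
  finally have e2: "(\<Sum>A\<in>Pow V. subset_weight q V A * Y2 A) < 1/2" using T(3) by simp
  have "(\<Sum>A\<in>Pow V. subset_weight q V A * Y1 A) / real z \<le> (real z / 2) / real z"
    using e1 by (rule divide_right_mono) simp
  then have "(\<Sum>A\<in>Pow V. subset_weight q V A * Y1 A) / real z \<le> 1 / 2" using z by simp
  moreover have "(\<Sum>A\<in>Pow V. subset_weight q V A * (Y1 A / real z + Y2 A)) =
      (\<Sum>A\<in>Pow V. subset_weight q V A * Y1 A) / real z + (\<Sum>A\<in>Pow V. subset_weight q V A * Y2 A)"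
    by (simp add: distrib_left sum.distrib sum_divide_distrib)
  ultimately have "(\<Sum>A\<in>Pow V. subset_weight q V A * (Y1 A / real z + Y2 A)) < 1" using e2 by linarith
  from exists_less_one_of_expectation[OF V q this]
  obtain G where G: "G \<subseteq> V" "Y1 G / real z + Y2 G < 1" by blast
  have Y1G: "Y1 G = real (card {E\<in>\<S>. E \<subseteq> G})"
    unfolding Y1_def using S(1) by (simp add: sum.If_cases of_bool_def Int_def)
  have "0 \<le> Y2 G" unfolding Y2_def by (intro sum_nonneg) simp
  then have "Y1 G / real z < 1" using G by linarith
  then have "card {E\<in>\<S>. E \<subseteq> G} < z" using z Y1G by simp
  moreover have "z < card (G \<inter> D s)" if s: "s \<in> T" for s
  proof (rule ccontr)
    assume "\<not> ?thesis"
    then have "(2::real) ^ card (G \<inter> D s) \<le> 2 ^ z" by (intro power_increasing) auto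
    then have "1 \<le> (2::real) ^ z * (1/2) ^ card (G \<inter> D s)" by (simp add: power_divide)
    also have "\<dots> \<le> Y2 G" unfolding Y2_def
      by (rule member_le_sum[OF s _ T(1)]) simp
    finally have "1 \<le> Y2 G" .
    moreover have "0 \<le> Y1 G / real z" using Y1G by simp
    ultimately show False using G by linarith
  qed
  ultimately show ?thesis using G(1) by blast
qed

text \<open>Comparison term by term with the binomial expansion of
  \<open>(card V + 1) ^ t\<close>.\<close>

lemma card_small_subsets_le:
  assumes "finite V"
  shows "card {S. S \<subseteq> V \<and> card S \<le> t} \<le> (card V + 1) ^ t"
proof -
  have "{S. S \<subseteq> V \<and> card S \<le> t} = (\<Union>i\<in>{..t}. {S. S \<subseteq> V \<and> card S = i})" by auto
  then have "card {S. S \<subseteq> V \<and> card S \<le> t} \<le> (\<Sum>i\<le>t. card {S. S \<subseteq> V \<and> card S = i})"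
    using card_UN_le[of "{..t}" "\<lambda>i. {S. S \<subseteq> V \<and> card S = i}"] by simp
  also have "\<dots> \<le> (\<Sum>i\<le>t. (t choose i) * card V ^ i * 1 ^ (t - i))"
  proof (rule sum_mono)
    fix i assume "i \<in> {..t}"
    have "card {S. S \<subseteq> V \<and> card S = i} = card V choose i" by (rule n_subsets[OF assms])
    also have "\<dots> \<le> card V ^ i" by (cases "i \<le> card V") (simp_all add: binomial_le_pow binomial_eq_0)
    also have "\<dots> \<le> (t choose i) * card V ^ i" using \<open>i \<in> {..t}\<close> by (simp add: zero_less_binomial_iff Suc_leI)
    finally show "card {S. S \<subseteq> V \<and> card S = i} \<le> (t choose i) * card V ^ i * 1 ^ (t - i)" by simp
  qed
  also have "\<dots> = (card V + 1) ^ t" by (simp only: binomial of_nat_id)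
  finally show ?thesis .
qed

text \<open>The sum is the expected number of \<open>l\<close>-cycles: at most
  \<open>card A ^ l\<close> copies, each with \<open>l\<close> edges.\<close>

lemma sum_cycle_copies_le:
  fixes q :: real
  assumes A: "finite A" and q: "0 \<le> q" and l: "3 \<le> l"
  shows "(\<Sum>E\<in>cycle_copies l A. q ^ card E) \<le> (real (card A) * q) ^ l"
proof -
  have "cycle_copies l A \<subseteq> (\<lambda>f. (`) f ` edges (cycle_graph l)) ` ({..<l} \<rightarrow>\<^sub>E A)"
  proof
    fix E assume "E \<in> cycle_copies l A"
    then obtain f where f: "f ` {..<l} \<subseteq> A" "E = (`) f ` edges (cycle_graph l)"
      unfolding cycle_copies_def by blast
    have "restrict f {..<l} \<in> {..<l} \<rightarrow>\<^sub>E A" using f(1) by auto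
    moreover have "E = (`) (restrict f {..<l}) ` edges (cycle_graph l)"
      unfolding image_edges_cycle_graph f(2) using l by (intro image_cong refl) auto
    ultimately show "E \<in> (\<lambda>f. (`) f ` edges (cycle_graph l)) ` ({..<l} \<rightarrow>\<^sub>E A)" by blast
  qed
  from surj_card_le[OF _ this] have "card (cycle_copies l A) \<le> card ({..<l} \<rightarrow>\<^sub>E A)"
    using A by (simp add: finite_PiE)
  also have "\<dots> = card A ^ l" by (simp add: card_PiE)
  finally have "real (card (cycle_copies l A)) \<le> real (card A) ^ l"
    unfolding of_nat_power[symmetric] of_nat_le_iff .
  then have "real (card (cycle_copies l A)) * q ^ l \<le> real (card A) ^ l * q ^ l"
    using q by (intro mult_right_mono) auto
  then show ?thesis using cycle_copy_facts(1)[OF _ l, of _ A] by (simp add: power_mult_distrib)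
qed

lemma two_times_choose_two_le: "2 * (n choose 2) \<le> n\<^sup>2"
proof -
  have "2 * (n choose 2) \<le> n * (n - 1)" unfolding choose_two by (rule times_div_less_eq_dividend)
  also have "\<dots> \<le> n * n" by (rule mult_le_mono2) simp
  finally show ?thesis by (simp add: power2_eq_square)
qed

text \<open>\<open>G\<close> is fixed before any colouring and is good for all tuples in
  \<open>W\<close> at once; a colouring then merely selects a tuple. The hypotheses
  \<open>short\<close> and \<open>union\<close> are the two expectation bounds behind the choice of
  \<open>G\<close>.\<close>

lemma cycle_ramsey_edge_set:
  fixes k r R m n a z T :: nat and q :: real
  assumes k: "4 \<le> k" and r: "1 \<le> r" and R: "R = ramsey_number (cycle_graph k) r"
    and n: "n = m ^ (k - 1)" "R \<le> n"
    and a: "1 \<le> a" "2 * a \<le> m ^ (k - 2)" "k ^ k * a ^ (k - 2) \<le> m" "r * R ^ k * k ^ k \<le> a ^ (k - 1)"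
    and q: "0 \<le> q" "q \<le> 1" and z: "0 < z"
    and short: "(\<Sum>l=3..<k. (real n * q) ^ l) \<le> real z / 2"
    and T: "real k * 2 ^ (k + 2) * (real a / real m ^ (k - 2)) * real (n choose 2) < real T + 1"
    and union: "\<And>d. n choose 2 \<le> R\<^sup>2 * d \<Longrightarrow>
      2 ^ z * (1 - q / 2) ^ d * real (((n choose 2) + 1) ^ (T * r)) \<le> 1 / 4"
  shows "\<exists>F\<subseteq>nsets {..<n} 2.
    (\<forall>l. 3 \<le> l \<longrightarrow> l < k \<longrightarrow> (\<forall>E\<in>cycle_copies l {..<n}. \<not> E \<subseteq> F)) \<and>
    (\<forall>c. (\<forall>e\<in>F. c e < r) \<longrightarrow>
      (\<exists>E\<in>cycle_copies k {..<n}. E \<subseteq> F \<and> (\<exists>i<r. \<forall>e\<in>E. c e = i)))"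
proof -
  define A where "A = {..<n}"
  define V where "V = nsets A 2"
  have A: "finite A" "card A = n" by (simp_all add: A_def)
  have k3: "3 \<le> k" using k by simp
  have V: "finite V" "card V = n choose 2" unfolding V_def using finite_imp_finite_nsets[OF A(1)] A by auto
  have kR: "k \<le> R" using ramsey_number_cycle_ge(1)[OF r k] R by simp
  have "\<exists>C. \<forall>I. I \<subseteq> V \<longrightarrow> (\<forall>E\<in>cycle_copies k A. \<not> E \<subseteq> I) \<longrightarrow>
    (\<exists>S\<subseteq>I. real (card S) \<le> real k * 2 ^ (k + 2) * (real a / real m ^ (k - 2)) * real (n choose 2) \<and>
      I \<subseteq> C S \<and> real (card {E\<in>cycle_copies k A. E \<subseteq> C S})
        \<le> real n ^ (k - 2) / real a ^ (k - 1) * real (n choose 2))"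
    using cycle_containers[OF k A(1) _ a(1-3)] A(2) n(1) unfolding V_def by simp
  then obtain C where C: "\<forall>I. I \<subseteq> V \<longrightarrow> (\<forall>E\<in>cycle_copies k A. \<not> E \<subseteq> I) \<longrightarrow>
    (\<exists>S\<subseteq>I. real (card S) \<le> real k * 2 ^ (k + 2) * (real a / real m ^ (k - 2)) * real (n choose 2) \<and>
      I \<subseteq> C S \<and> real (card {E\<in>cycle_copies k A. E \<subseteq> C S})
        \<le> real n ^ (k - 2) / real a ^ (k - 1) * real (n choose 2))" ..
  \<comment> \<open>The pairs left uncovered by the containers of the \<open>r\<close> fingerprints
    in \<open>s\<close>.\<close>
  define D where "D s = V - (\<Union>i<r. C (s i))" for s :: "nat \<Rightarrow> nat set set"
  define small where "small = {S. S \<subseteq> V \<and> card S \<le> T}"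
  \<comment> \<open>Supersaturation will show that each colouring without a monochromatic
    \<open>k\<close>-cycle leads to a tuple in \<open>W\<close>.\<close>
  define W where "W = {s \<in> {..<r} \<rightarrow>\<^sub>E small. n choose 2 \<le> R\<^sup>2 * card (D s)}"
  define \<S> where "\<S> = (\<Union>l\<in>{3..<k}. cycle_copies l A)"
  have finsmall: "finite small" unfolding small_def using V(1) by simp
  have finPi: "finite ({..<r} \<rightarrow>\<^sub>E small)" using finsmall by (intro finite_PiE) auto
  have finW: "finite W" unfolding W_def using finPi by simp
  have cW: "real (card W) \<le> real (((n choose 2) + 1) ^ (T * r))"
  proof -
    have "card W \<le> card ({..<r} \<rightarrow>\<^sub>E small)" unfolding W_def by (rule card_mono[OF finPi]) auto
    also have "\<dots> = card small ^ r" by (simp add: card_PiE)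
    also have "\<dots> \<le> (((n choose 2) + 1) ^ T) ^ r"
      unfolding small_def using card_small_subsets_le[OF V(1), of T] V(2) by (intro power_mono) auto
    finally show ?thesis by (simp only: power_mult of_nat_le_iff)
  qed
  have fin\<S>: "finite \<S>" unfolding \<S>_def using finite_cycle_copies[OF A(1)] by auto
  have \<S>V: "E \<subseteq> V" if "E \<in> \<S>" for E
  proof -
    obtain l where "3 \<le> l" "E \<in> cycle_copies l A" using \<open>E \<in> \<S>\<close> unfolding \<S>_def by auto
    then show ?thesis unfolding V_def using cycle_copy_facts(2) by blast
  qed
  have s1: "(\<Sum>E\<in>\<S>. q ^ card E) \<le> real z / 2"
  proof -
    have "(\<Sum>E\<in>\<S>. q ^ card E) \<le> (\<Sum>l\<in>{3..<k}. \<Sum>E\<in>cycle_copies l A. q ^ card E)"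
    proof -
      \<comment> \<open>The sum over the union is at most the sum over the disjoint union of the
        families for the single lengths.\<close>
      have "\<S> = snd ` (SIGMA l:{3..<k}. cycle_copies l A)" unfolding \<S>_def by force
      then have "(\<Sum>E\<in>\<S>. q ^ card E) \<le> (\<Sum>x\<in>(SIGMA l:{3..<k}. cycle_copies l A). q ^ card (snd x))"
        using finite_cycle_copies[OF A(1)] q by (auto intro!: sum_image_le[of _ "\<lambda>E. q ^ card E" snd, unfolded comp_def])
      also have "\<dots> = (\<Sum>l\<in>{3..<k}. \<Sum>E\<in>cycle_copies l A. q ^ card E)"
        using finite_cycle_copies[OF A(1)] by (subst sum.Sigma) (auto simp: split_def)
      finally show ?thesis .
    qed
    also have "\<dots> \<le> (\<Sum>l\<in>{3..<k}. (real n * q) ^ l)"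
      using sum_cycle_copies_le[OF A(1) q(1)] A(2) by (intro sum_mono) auto
    finally show ?thesis using short by simp
  qed
  have s2: "(\<Sum>s\<in>W. 2 ^ z * (1 - q / 2) ^ card (D s)) < 1/2"
  proof -
    define K where "K = real (((n choose 2) + 1) ^ (T * r))"
    have K: "0 < K" unfolding K_def by simp
    have "(\<Sum>s\<in>W. 2 ^ z * (1 - q / 2) ^ card (D s)) \<le> (\<Sum>s\<in>W. 1 / 4 / K)"
    proof (rule sum_mono)
      fix s assume "s \<in> W"
      then show "2 ^ z * (1 - q / 2) ^ card (D s) \<le> 1 / 4 / K"
        using union[of "card (D s)"] K unfolding W_def K_def[symmetric] by (simp add: field_simps)
    qed
    also have "\<dots> \<le> 1 / 4" using cW K unfolding K_def[symmetric] by (simp add: field_simps)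
    finally show ?thesis by simp
  qed
  have "\<exists>G\<subseteq>V. card {E\<in>\<S>. E \<subseteq> G} < z \<and> (\<forall>s\<in>W. z < card (G \<inter> D s))"
    by (rule exists_sparse_hitting_set[OF V(1) q z fin\<S> \<S>V s1 finW _ s2]) (auto simp: D_def)
  then obtain G where G: "G \<subseteq> V" "card {E\<in>\<S>. E \<subseteq> G} < z" "\<And>s. s \<in> W \<Longrightarrow> z < card (G \<inter> D s)" by blast
  define B where "B = {E\<in>\<S>. E \<subseteq> G}"
  \<comment> \<open>The edge to be deleted from a short cycle. Members of \<open>B\<close> are
    nonempty, so the chosen edge belongs to the cycle.\<close>
  define \<rho> where "\<rho> E = (SOME e. e \<in> E)" for E :: "nat set set"
  define F where "F = G - \<rho> ` B"
  have finB: "finite B" unfolding B_def using fin\<S> by simp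
  have FV: "F \<subseteq> V" using G(1) by (auto simp: F_def)
  have cyc: "\<not> E \<subseteq> F" if l: "3 \<le> l" "l < k" and E: "E \<in> cycle_copies l A" for l E
  proof
    assume EF: "E \<subseteq> F"
    have "E \<noteq> {}" using cycle_copy_facts(1)[OF E l(1)] l(1) by auto
    then have e: "\<rho> E \<in> E" unfolding \<rho>_def by (rule some_in_eq[THEN iffD2])
    have "E \<in> \<S>" using l E unfolding \<S>_def by auto
    moreover have "E \<subseteq> G" using EF by (auto simp: F_def)
    ultimately have "E \<in> B" by (simp add: B_def)
    then show False using e EF by (auto simp: F_def)
  qed
  have ram: "\<exists>E\<in>cycle_copies k A. E \<subseteq> F \<and> (\<exists>i<r. \<forall>e\<in>E. c e = i)" if c: "\<forall>e\<in>F. c e < r" for c :: "nat set \<Rightarrow> nat"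
  proof (rule ccontr)
    assume no: "\<not> ?thesis"
    define I where "I i = {e \<in> F. c e = i}" for i
    have IV: "I i \<subseteq> V" for i using FV by (auto simp: I_def)
    have ind: "\<forall>E\<in>cycle_copies k A. \<not> E \<subseteq> I i" if "i < r" for i
    proof
      fix E assume E: "E \<in> cycle_copies k A"
      show "\<not> E \<subseteq> I i"
      proof
        assume "E \<subseteq> I i"
        then have "E \<subseteq> F" "\<forall>e\<in>E. c e = i" unfolding I_def by auto
        then show False using no E that by blast
      qed
    qed
    have "\<forall>i\<in>{..<r}. \<exists>S. S \<subseteq> I i \<and> real (card S) \<le> real k * 2 ^ (k + 2) * (real a / real m ^ (k - 2)) * real (n choose 2) \<and>
      I i \<subseteq> C S \<and> real (card {E\<in>cycle_copies k A. E \<subseteq> C S})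
        \<le> real n ^ (k - 2) / real a ^ (k - 1) * real (n choose 2)"
    proof
      fix i assume "i \<in> {..<r}"
      then have "i < r" by simp
      from C[rule_format, OF IV bspec[OF ind[OF this]]] show "\<exists>S. S \<subseteq> I i \<and> real (card S) \<le> real k * 2 ^ (k + 2) * (real a / real m ^ (k - 2)) * real (n choose 2) \<and>
        I i \<subseteq> C S \<and> real (card {E\<in>cycle_copies k A. E \<subseteq> C S})
          \<le> real n ^ (k - 2) / real a ^ (k - 1) * real (n choose 2)" .
    qed
    from bchoice[OF this] obtain S where S': "\<forall>i\<in>{..<r}. S i \<subseteq> I i \<and>
      real (card (S i)) \<le> real k * 2 ^ (k + 2) * (real a / real m ^ (k - 2)) * real (n choose 2) \<and>
      I i \<subseteq> C (S i) \<and> real (card {E\<in>cycle_copies k A. E \<subseteq> C (S i)})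
        \<le> real n ^ (k - 2) / real a ^ (k - 1) * real (n choose 2)" ..
    have S: "S i \<subseteq> I i"
      "real (card (S i)) \<le> real k * 2 ^ (k + 2) * (real a / real m ^ (k - 2)) * real (n choose 2)"
      "I i \<subseteq> C (S i)"
      "real (card {E\<in>cycle_copies k A. E \<subseteq> C (S i)})
        \<le> real n ^ (k - 2) / real a ^ (k - 1) * real (n choose 2)" if "i < r" for i
      using bspec[OF S', of i] that by simp_all
    define s where "s = restrict S {..<r}"
    have sS: "s i = S i" if "i < r" for i using that by (simp add: s_def)
    have Ds: "D s = V - (\<Union>i<r. C (S i))" unfolding D_def using sS by auto
    have "S i \<in> small" if "i < r" for i
    proof -
      have "real (card (S i)) < real T + 1" using S(2)[OF that] T by linarith
      then have "card (S i) \<le> T" by linarith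
      then show ?thesis using S(1)[OF that] IV unfolding small_def by blast
    qed
    then have sPi: "s \<in> {..<r} \<rightarrow>\<^sub>E small" unfolding s_def by auto
    \<comment> \<open>The container bounds are compared with
      \<open>(n / k) ^ k \<le> n choose k\<close> and \<open>R choose k \<le> R ^ k\<close>; what
      remains is the hypothesis \<open>r * R ^ k * k ^ k \<le> a ^ (k - 1)\<close>.\<close>
    have few: "(\<Sum>i<r. card {E \<in> cycle_copies k A. E \<subseteq> C (S i)}) * 2 * (R choose k) \<le> card A choose k"
    proof -
      have n1: "real (n choose 2) \<le> real n ^ 2 / 2"
      proof -
        have "real (2 * (n choose 2)) \<le> real (n\<^sup>2)" by (rule of_nat_mono[OF two_times_choose_two_le])
        then show ?thesis by simp
      qed
      have apos: "0 < real a ^ (k - 1)" using a by simp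
      have kn: "k \<le> n" using kR n by simp
      have e: "real (card {E \<in> cycle_copies k A. E \<subseteq> C (S i)}) \<le> real n ^ k / (2 * real a ^ (k - 1))" if "i < r" for i
      proof -
        have "real n ^ (k - 2) / real a ^ (k - 1) * real (n choose 2) \<le> real n ^ (k - 2) / real a ^ (k - 1) * (real n ^ 2 / 2)"
          using n1 by (rule mult_left_mono) simp
        also have "\<dots> = (real n ^ (k - 2) * real n ^ 2) / (2 * real a ^ (k - 1))" by simp
        also have "real n ^ (k - 2) * real n ^ 2 = real n ^ k"
          unfolding power_add[symmetric] using k by (intro arg_cong[of _ _ "\<lambda>j. real n ^ j"]) simp
        finally show ?thesis using S(4)[OF that] by linarith
      qed
      have "real ((\<Sum>i<r. card {E \<in> cycle_copies k A. E \<subseteq> C (S i)}) * 2 * (R choose k))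
        = (\<Sum>i<r. real (card {E \<in> cycle_copies k A. E \<subseteq> C (S i)})) * 2 * real (R choose k)" by simp
      also have "\<dots> \<le> (\<Sum>i<r. real n ^ k / (2 * real a ^ (k - 1))) * 2 * real (R ^ k)"
        using e binomial_le_pow[OF kR] by (intro mult_mono sum_mono of_nat_mono mult_right_mono) (auto intro!: sum_nonneg)
      also have "\<dots> = real n ^ k * (real (r * R ^ k) / real a ^ (k - 1))" by simp
      also have "\<dots> \<le> real n ^ k * (1 / real k ^ k)"
      proof (rule mult_left_mono)
        have "real (r * R ^ k * k ^ k) \<le> real (a ^ (k - 1))" using a(4) by (rule of_nat_mono)
        then show "real (r * R ^ k) / real a ^ (k - 1) \<le> 1 / real k ^ k"
          using apos k by (simp add: field_simps)
      qed simp
      also have "\<dots> = (real n / real k) ^ k" by (simp add: power_divide)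
      also have "\<dots> \<le> real (n choose k)" by (rule binomial_ge_n_over_k_pow_k[OF kn])
      finally show ?thesis unfolding of_nat_le_iff A(2) .
    qed
    have "n choose 2 \<le> 2 * card (D s) * (R choose 2)"
      using supersaturation[OF k r R A(1) _ few] n(2) A(2) unfolding Ds V_def by simp
    also have "\<dots> = (2 * (R choose 2)) * card (D s)" by simp
    also have "\<dots> \<le> R\<^sup>2 * card (D s)"
      by (rule mult_le_mono1[OF two_times_choose_two_le])
    finally have "s \<in> W" using sPi unfolding W_def by blast
    from G(3)[OF this] have big: "z < card (G \<inter> D s)" .
    \<comment> \<open>An edge of \<open>G\<close> that survives the deletion has a colour and lies
      in the container of its colour class. So an uncovered edge of \<open>G\<close> must have been
      deleted.\<close>
    have "G \<inter> D s \<subseteq> \<rho> ` B"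
    proof
      fix e assume e: "e \<in> G \<inter> D s"
      show "e \<in> \<rho> ` B"
      proof (rule ccontr)
        assume "e \<notin> \<rho> ` B"
        then have eF: "e \<in> F" using e by (auto simp: F_def)
        then have "c e < r" "e \<in> I (c e)" using c by (auto simp: I_def)
        then have "e \<in> (\<Union>i<r. C (S i))" using S(3) by blast
        then show False using e unfolding Ds by blast
      qed
    qed
    then have "card (G \<inter> D s) \<le> card (\<rho> ` B)" using finB by (intro card_mono) auto
    also have "\<dots> \<le> card B" by (rule card_image_le[OF finB])
    also have "\<dots> < z" using G(2) by (simp add: B_def)
    finally show False using big by simp
  qed
  show ?thesis using FV cyc ram unfolding A_def V_def by blast
qed

section \<open>Choice of parameters\<close>

lemma exp_two_ge: "4 \<le> exp (2::real)"
proof -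
  have "2 \<le> exp (1::real)" using exp_ge_add_one_self[of 1] by simp
  then have "2 * 2 \<le> exp 1 * exp (1::real)" by (intro mult_mono) auto
  then show ?thesis by (simp flip: exp_add)
qed

text \<open>\<open>2 \<le> exp 1\<close> and \<open>1 - x \<le> exp (- x)\<close> reduce the claim
  to a comparison of exponents. The summand 2 in \<open>main\<close> pays for the right-hand side,
  as \<open>4 \<le> exp 2\<close>.\<close>

lemma exp_le_union_bound:
  fixes q L :: real
  assumes q: "0 \<le> q" "q \<le> 1" and L: "real M \<le> exp L" and M: "1 \<le> M"
    and main: "real z + real t * L + 2 \<le> q * real d / 2"
  shows "2 ^ z * (1 - q / 2) ^ d * real (M ^ t) \<le> 1 / 4"
proof -
  have "(2::real) \<le> exp 1" using exp_ge_add_one_self[of 1] by simp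
  then have 1: "(2::real) ^ z \<le> exp (real z)"
    using power_mono[of 2 "exp (1::real)" z] by (simp flip: exp_of_nat_mult)
  have "1 - q / 2 \<le> exp (- (q / 2))" using exp_ge_add_one_self[of "- (q / 2)"] by simp
  then have "(1 - q / 2) ^ d \<le> exp (- (q / 2)) ^ d" using q by (intro power_mono) auto
  also have "\<dots> = exp (- (q * real d / 2))" by (simp flip: exp_of_nat_mult)
  finally have 2: "(1 - q / 2) ^ d \<le> exp (- (q * real d / 2))" .
  have "real M ^ t \<le> exp L ^ t" using L by (intro power_mono) auto
  then have 3: "real (M ^ t) \<le> exp (real t * L)" by (simp add: exp_of_nat_mult)
  have "2 ^ z * (1 - q / 2) ^ d * real (M ^ t) \<le> exp (real z) * exp (- (q * real d / 2)) * exp (real t * L)"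
    using 1 2 3 q by (intro mult_mono) auto
  also have "\<dots> = exp (real z - q * real d / 2 + real t * L)"
    unfolding exp_add[symmetric] by simp
  also have "\<dots> \<le> exp (- 2)" using main by simp
  also have "\<dots> \<le> 1 / 4" using exp_two_ge by (simp add: exp_minus field_simps)
  finally show ?thesis .
qed

lemma power_prod_mono:
  fixes k R :: nat
  assumes "1 \<le> k" "1 \<le> R" "x \<le> x'" "y \<le> y'"
  shows "k ^ x * R ^ y \<le> k ^ x' * R ^ y'"
  using assms by (intro mult_mono power_increasing) auto

text \<open>
The containers are used with density \<open>a / m ^ (k - 2)\<close> and the random graph with density \<open>q\<close>; the
fingerprints have at most \<open>\<tau>\<close> edges, and fewer than \<open>z\<close> edges are deleted. The exponents of \<open>b\<close> make
\<open>q\<close> outweigh the number of choices of fingerprints, and those of \<open>m\<close> make \<open>z\<close> negligible against the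
expected number of edges, while \<open>m ^ k\<close> is the prescribed order.
\<close>

locale girth_ramsey_parameters =
  fixes k r R m n a b z :: nat and q \<tau> :: real
  assumes k: "4 \<le> k" and r: "r \<le> R" and R: "k \<le> R"
  defines "m \<equiv> k ^ (15 * k\<^sup>2) * R ^ (10 * k)" and "n \<equiv> m ^ (k - 1)"
    and "a \<equiv> k\<^sup>2 * R\<^sup>2" and "b \<equiv> k ^ (4 * k) * R ^ 6" and "z \<equiv> 4 * k * (b * m) ^ (k - 1)"
    and "q \<equiv> real b / real m ^ (k - 2)"
    and "\<tau> \<equiv> real k * 2 ^ (k + 2) * (real a / real m ^ (k - 2)) * real (n choose 2)"
begin

lemma kR: "1 \<le> k" "1 \<le> R" "4 \<le> R" using k R by auto

lemma k2: "4 * k \<le> k\<^sup>2" using k by (simp add: power2_eq_square)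

text \<open>Lower bounds on \<open>m\<close> are checked by comparing the exponents of
  \<open>k\<close> and of \<open>R\<close> separately.\<close>

lemma m_ge: "x \<le> 15 * k\<^sup>2 \<Longrightarrow> y \<le> 10 * k \<Longrightarrow> k ^ x * R ^ y \<le> m"
  unfolding m_def by (rule power_prod_mono[OF kR(1,2)])

lemma m_pos: "1 \<le> m" using kR by (simp add: m_def)

lemma b_pos: "1 \<le> b" using kR by (simp add: b_def)

lemma a_pos: "1 \<le> a" using kR by (simp add: a_def)

lemma m_le_power: "1 \<le> j \<Longrightarrow> m \<le> m ^ j" using m_pos by (intro self_le_power) auto

lemma R_le_n: "R \<le> n"
proof -
  have "k ^ 0 * R ^ 1 \<le> m" using k by (intro m_ge) auto
  also have "m \<le> n" unfolding n_def using k by (intro m_le_power) auto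
  finally show ?thesis by simp
qed

lemma two_a_le: "2 * a \<le> m ^ (k - 2)"
proof -
  have "2 * a \<le> k * a" using k by (intro mult_right_mono) auto
  also have "\<dots> = k ^ 3 * R ^ 2" by (simp add: a_def power3_eq_cube power2_eq_square)
  also have "\<dots> \<le> m" using k k2 by (intro m_ge) auto
  also have "m \<le> m ^ (k - 2)" using k by (intro m_le_power) auto
  finally show ?thesis .
qed

lemma a_power_le_m: "k ^ k * a ^ (k - 2) \<le> m"
proof -
  have "k ^ k * a ^ (k - 2) = k ^ (k + 2 * (k - 2)) * R ^ (2 * (k - 2))"
    by (simp add: a_def power_mult_distrib power_mult[symmetric] power_add)
  also have "\<dots> \<le> m" using k k2 by (intro m_ge) auto
  finally show ?thesis .
qed

lemma r_power_le_a_power: "r * R ^ k * k ^ k \<le> a ^ (k - 1)"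
proof -
  have "r * R ^ k * k ^ k \<le> k ^ k * R ^ (k + 1)" using r by simp
  also have "\<dots> \<le> k ^ (2 * (k - 1)) * R ^ (2 * (k - 1))" using k kR by (intro power_prod_mono) auto
  also have "\<dots> = a ^ (k - 1)" by (simp add: a_def power_mult_distrib power_mult[symmetric])
  finally show ?thesis .
qed

lemma q_bounds: "0 \<le> q" "q \<le> 1"
proof -
  show "0 \<le> q" by (simp add: q_def)
  have "b \<le> m" unfolding b_def using k k2 by (intro m_ge) auto
  also have "m \<le> m ^ (k - 2)" using k by (intro m_le_power) auto
  finally have "real b \<le> real m ^ (k - 2)" by (metis of_nat_le_iff of_nat_power)
  then show "q \<le> 1" using m_pos by (simp add: q_def)
qed

lemma n_times_q: "real n * q = real (b * m)"
proof -
  have "k - 1 = Suc (k - 2)" using k by simp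
  then have "real n = real m * real m ^ (k - 2)" unfolding n_def by simp
  then show ?thesis using m_pos by (simp add: q_def)
qed

lemma z_pos: "0 < z" using k b_pos m_pos by (simp add: z_def)

text \<open>As \<open>b * m \<ge> 1\<close>, length \<open>k - 1\<close> gives the largest term, and
  there are fewer than \<open>k\<close> lengths. The factor \<open>4 * k\<close> in \<open>z\<close>
  covers this together with the halving.\<close>

lemma short_cycles: "(\<Sum>l=3..<k. (real n * q) ^ l) \<le> real z / 2"
proof -
  have "1 \<le> b * m" using b_pos m_pos by simp
  then have "real 1 \<le> real (b * m)" by (rule of_nat_mono)
  then have bm: "1 \<le> real (b * m)" by (simp only: of_nat_1)
  have "(\<Sum>l=3..<k. (real n * q) ^ l) \<le> (\<Sum>l=3..<k. real (b * m) ^ (k - 1))"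
    unfolding n_times_q by (intro sum_mono power_increasing bm) auto
  also have "\<dots> \<le> real k * real (b * m) ^ (k - 1)" by (simp add: mult_right_mono)
  also have "\<dots> \<le> real z / 2" by (simp add: z_def)
  finally show ?thesis .
qed

lemma choose_two_bounds: "real n ^ 2 / 4 \<le> real (n choose 2)" "(n choose 2) + 1 \<le> m ^ (2 * k)"
proof -
  have n2: "2 \<le> n" using R_le_n kR by simp
  have "even (n * (n - 1))" by (cases "even n") simp_all
  then have e: "2 * (n choose 2) = n * (n - 1)" unfolding choose_two by simp
  then have "real (2 * (n choose 2)) = real (n * (n - 1))" by (rule arg_cong)
  then have "2 * real (n choose 2) = real n * (real n - 1)" using n2 by (simp add: of_nat_diff)
  moreover have "real n * 2 \<le> real n * real n" using n2 by (intro mult_left_mono) auto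
  ultimately show "real n ^ 2 / 4 \<le> real (n choose 2)"
    by (simp add: power2_eq_square right_diff_distrib)
  have "2 * 2 \<le> n * n" using n2 by (intro mult_le_mono) auto
  moreover have "n * (n - 1) \<le> n * n" by simp
  ultimately have "(n choose 2) + 1 \<le> n * n" using e by linarith
  also have "\<dots> = m ^ (2 * (k - 1))" by (simp add: n_def power_add[symmetric] mult_2)
  also have "\<dots> \<le> m ^ (2 * k)" using m_pos by (intro power_increasing) auto
  finally show "(n choose 2) + 1 \<le> m ^ (2 * k)" .
qed

text \<open>The inequality \<open>x \<le> exp x\<close> for \<open>k\<close> and \<open>R\<close>
  replaces logarithms by linear terms. The constant 5 exceeds \<open>15/4 + 10/16\<close>, which
  results from \<open>4 \<le> R\<close> and \<open>16 \<le> k * k\<close>.\<close>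

lemma m_le_exp: "real m \<le> exp (5 * real k ^ 3 * real R)"
proof -
  have le: "real x \<le> exp (real x)" for x using exp_ge_add_one_self[of "real x"] by linarith
  have "real m = real k ^ (15 * k\<^sup>2) * real R ^ (10 * k)" by (simp add: m_def)
  also have "\<dots> \<le> exp (real k) ^ (15 * k\<^sup>2) * exp (real R) ^ (10 * k)"
    using le by (intro mult_mono power_mono) auto
  also have "\<dots> = exp (15 * real k ^ 3 + 10 * real k * real R)"
    by (simp add: exp_add power3_eq_cube power2_eq_square mult_ac flip: exp_of_nat_mult)
  also have "\<dots> \<le> exp (5 * real k ^ 3 * real R)"
  proof -
    have "real k ^ 3 * 4 \<le> real k ^ 3 * real R" using kR by (intro mult_left_mono) auto
    moreover have "16 * (real k * real R) \<le> real k ^ 3 * real R"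
    proof -
      have "4 * 4 \<le> real k * real k" using k by (intro mult_mono) auto
      then have "16 * (real k * real R) \<le> (real k * real k) * (real k * real R)"
        by (intro mult_right_mono) auto
      then show ?thesis by (simp add: power3_eq_cube mult_ac)
    qed
    moreover have "0 \<le> real k ^ 3 * real R" by simp
    ultimately have "15 * real k ^ 3 + 10 * (real k * real R) \<le> 5 * (real k ^ 3 * real R)" by linarith
    then show ?thesis by (simp add: mult_ac)
  qed
  finally show ?thesis .
qed

lemma choose_two_le_exp: "real ((n choose 2) + 1) \<le> exp (10 * real k ^ 4 * real R)"
proof -
  have "real ((n choose 2) + 1) \<le> real (m ^ (2 * k))" using choose_two_bounds(2) by (rule of_nat_mono)
  also have "\<dots> = real m ^ (2 * k)" by simp
  also have "\<dots> \<le> exp (5 * real k ^ 3 * real R) ^ (2 * k)" using m_le_exp by (intro power_mono) auto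
  also have "\<dots> = exp (10 * real k ^ 4 * real R)"
    by (simp add: eval_nat_numeral mult_ac flip: exp_of_nat_mult)
  finally show ?thesis .
qed

lemma union_bound:
  assumes d: "n choose 2 \<le> R\<^sup>2 * d"
  shows "2 ^ z * (1 - q / 2) ^ d * real (((n choose 2) + 1) ^ (nat \<lfloor>\<tau>\<rfloor> * r)) \<le> 1 / 4"
proof (rule exp_le_union_bound[OF q_bounds choose_two_le_exp])
  define Q where "Q = real (n choose 2) / real m ^ (k - 2)"
  \<comment> \<open>\<open>P\<close> bounds \<open>q * d\<close>, the expected number of random
    edges among \<open>d\<close> pairs, from below. Half of it is available in the exponent: one
    quarter pays for the choices of fingerprints, another for \<open>z + 2\<close>.\<close>
  define P where "P = real (k ^ (4 * k)) * real R ^ 4 * Q"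
  have Q0: "0 \<le> Q" by (simp add: Q_def)
  have mp: "0 < real m" using m_pos by simp
  have Rp: "0 < real R" using kR by simp
  have Q: "real m ^ k / 4 \<le> Q"
  proof -
    have "2 * (k - 1) = k + (k - 2)" using k by simp
    then have "real n ^ 2 = real m ^ k * real m ^ (k - 2)"
      by (simp add: n_def power_mult[symmetric] power_add[symmetric] mult.commute)
    then have "real m ^ k * real m ^ (k - 2) / 4 \<le> real (n choose 2)" using choose_two_bounds(1) by simp
    then show ?thesis unfolding Q_def using mp by (simp add: field_simps)
  qed
  have fp: "real (nat \<lfloor>\<tau>\<rfloor> * r) * (10 * real k ^ 4 * real R) \<le> P / 4"
  proof -
    have \<tau>: "\<tau> = real k * 2 ^ (k + 2) * real a * Q" by (simp add: \<tau>_def Q_def)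
    have "0 \<le> \<tau>" unfolding \<tau> using Q0 by simp
    then have "real (nat \<lfloor>\<tau>\<rfloor>) \<le> \<tau>" by linarith
    then have "real (nat \<lfloor>\<tau>\<rfloor> * r) \<le> \<tau> * real R"
      unfolding of_nat_mult using r by (intro mult_mono) auto
    then have "real (nat \<lfloor>\<tau>\<rfloor> * r) * (10 * real k ^ 4 * real R) \<le> \<tau> * real R * (10 * real k ^ 4 * real R)"
      by (rule mult_right_mono) simp
    also have "\<dots> = real (40 * 2 ^ k * k ^ 7) * (real R ^ 4 * Q)"
      unfolding \<tau> a_def by (simp add: eval_nat_numeral mult_ac)
    also have "\<dots> \<le> real (k ^ (4 * k)) / 4 * (real R ^ 4 * Q)"
    proof (rule mult_right_mono)
      \<comment> \<open>Here the factor \<open>k ^ (4 * k)\<close> of \<open>b\<close> is needed: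
        160 is absorbed by \<open>k ^ 4\<close> and \<open>2 ^ k\<close> by \<open>k ^ k\<close>,
        and \<open>11 + k \<le> 4 * k\<close> holds from \<open>k = 4\<close> on.\<close>
      have "4 ^ 4 \<le> k ^ 4" using k by (intro power_mono) auto
      moreover have "2 ^ k \<le> k ^ k" using k by (intro power_mono) auto
      ultimately have "160 * 2 ^ k \<le> k ^ 4 * k ^ k" by (intro mult_le_mono) auto
      then have "160 * 2 ^ k * k ^ 7 \<le> k ^ 4 * k ^ k * k ^ 7" by (rule mult_le_mono1)
      also have "\<dots> = k ^ (11 + k)" by (simp add: power_add[symmetric])
      also have "\<dots> \<le> k ^ (4 * k)" using k by (intro power_increasing) auto
      finally have "real (160 * 2 ^ k * k ^ 7) \<le> real (k ^ (4 * k))" by (rule of_nat_mono)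
      then show "real (40 * 2 ^ k * k ^ 7) \<le> real (k ^ (4 * k)) / 4" by simp
    qed (use Q0 in simp)
    finally show ?thesis by (simp add: P_def)
  qed
  have zP: "real z + 2 \<le> P / 4"
  proof -
    \<comment> \<open>The exponents of \<open>m\<close> make \<open>m\<close> exceed
      \<open>128 * k * b ^ (k - 1)\<close>. Hence \<open>z\<close>, which is
      \<open>4 * k * b ^ (k - 1)\<close> times \<open>m ^ (k - 1)\<close>, is a small fraction of
      \<open>m ^ k\<close>.\<close>
    have "128 * k * b ^ (k - 1) \<le> k ^ 4 * k * b ^ (k - 1)"
    proof -
      have "4 ^ 4 \<le> k ^ 4" using k by (intro power_mono) auto
      then show ?thesis by (intro mult_le_mono1) simp
    qed
    also have "\<dots> = k ^ (5 + 4 * k * (k - 1)) * R ^ (6 * (k - 1))"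
    proof -
      have "k ^ 4 * k = k ^ 5" by (simp add: eval_nat_numeral)
      then show ?thesis by (simp add: b_def power_mult_distrib power_mult[symmetric] power_add)
    qed
    also have "\<dots> \<le> m"
    proof (rule m_ge)
      have "4 * k * (k - 1) \<le> 4 * k\<^sup>2" by (simp add: power2_eq_square)
      then show "5 + 4 * k * (k - 1) \<le> 15 * k\<^sup>2" using k2 k by linarith
    qed simp
    finally have mb: "128 * k * b ^ (k - 1) \<le> m" .
    have "2 * z = 8 * k * b ^ (k - 1) * m ^ (k - 1)" by (simp add: z_def power_mult_distrib)
    then have "16 * (2 * z) = 128 * k * b ^ (k - 1) * m ^ (k - 1)" by simp
    also have "\<dots> \<le> m * m ^ (k - 1)" using mb by (rule mult_le_mono1)
    also have "\<dots> = m ^ k" using k by (simp flip: power_Suc)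
    finally have "real (16 * (2 * z)) \<le> real (m ^ k)" by (rule of_nat_mono)
    then have "2 * real z \<le> Q / 4" using Q by simp
    moreover have "1 * Q \<le> real (k ^ (4 * k)) * real R ^ 4 * Q"
    proof (rule mult_right_mono[OF _ Q0])
      have "1 \<le> k ^ (4 * k) * R ^ 4" using kR by simp
      then have "real 1 \<le> real (k ^ (4 * k) * R ^ 4)" by (rule of_nat_mono)
      then show "1 \<le> real (k ^ (4 * k)) * real R ^ 4" by simp
    qed
    moreover have "2 \<le> z"
    proof -
      have "1 \<le> (b * m) ^ (k - 1)" using b_pos m_pos by simp
      then have "4 * k * 1 \<le> z" unfolding z_def by (rule mult_le_mono2)
      then show ?thesis using k by linarith
    qed
    ultimately show ?thesis unfolding P_def by linarith
  qed
  \<comment> \<open>Of the six factors \<open>R\<close> in \<open>b\<close>, two compensate the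
    proportion \<open>1 / R\<^sup>2\<close> of uncovered pairs and four remain in
    \<open>P\<close>.\<close>
  have "P / 2 \<le> q * real d / 2"
  proof -
    have "real (n choose 2) \<le> real (R\<^sup>2 * d)" using d by (rule of_nat_mono)
    then have "real b * real (n choose 2) \<le> real b * (real R ^ 2 * real d)" by (intro mult_left_mono) auto
    moreover have "real b = real (k ^ (4 * k)) * real R ^ 4 * real R ^ 2" by (simp add: b_def eval_nat_numeral)
    ultimately have "(real (k ^ (4 * k)) * real R ^ 4 * real (n choose 2)) * real R ^ 2 \<le> (real b * real d) * real R ^ 2"
      by (simp add: mult_ac)
    then have "real (k ^ (4 * k)) * real R ^ 4 * real (n choose 2) \<le> real b * real d"
      using Rp by simp
    then show ?thesis unfolding P_def Q_def q_def using mp by (simp add: field_simps)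
  qed
  then show "real z + real (nat \<lfloor>\<tau>\<rfloor> * r) * (10 * real k ^ 4 * real R) + 2 \<le> q * real d / 2"
    using fp zP by linarith
qed simp

lemma size: "m ^ k = k ^ (15 * k ^ 3) * R ^ (10 * k\<^sup>2)" "n \<le> m ^ k"
proof -
  have e: "15 * k\<^sup>2 * k = 15 * k ^ 3" "10 * k * k = 10 * k\<^sup>2"
    by (simp_all add: power3_eq_cube power2_eq_square)
  show "m ^ k = k ^ (15 * k ^ 3) * R ^ (10 * k\<^sup>2)"
    unfolding m_def power_mult_distrib power_mult[symmetric] e ..
  show "n \<le> m ^ k" unfolding n_def using m_pos by (intro power_increasing) auto
qed

end

section \<open>The girth Ramsey theorem\<close>

text \<open>Every vertex of a cycle lies on one of its edges. So isolated vertices added to a graph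
  create no cycles.\<close>

lemma cycle_copies_restrict:
  assumes E: "E \<in> cycle_copies l A" "E \<subseteq> nsets B 2" and l: "3 \<le> l"
  shows "E \<in> cycle_copies l B"
proof -
  obtain f where f: "inj_on f {..<l}" "E = (\<lambda>i. {f i, f (Suc i mod l)}) ` {..<l}" "\<Union>E = f ` {..<l}"
    by (rule cycle_copy_cases[OF E(1) l])
  have "\<Union>E \<subseteq> B" using E(2) by (auto simp: nsets_def)
  then show ?thesis unfolding cycle_copies_def image_edges_cycle_graph using f by auto
qed

lemma girth_eqI:
  assumes k: "3 \<le> k" and "\<exists>E\<in>cycle_copies k (verts G). E \<subseteq> edges G"
    and "\<And>l E. 3 \<le> l \<Longrightarrow> l < k \<Longrightarrow> E \<in> cycle_copies l (verts G) \<Longrightarrow> \<not> E \<subseteq> edges G"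
  shows "girth G = enat k"
proof -
  have copy: "(\<exists>f. is_copy f (cycle_graph l) G) \<longleftrightarrow> (\<exists>E\<in>cycle_copies l (verts G). E \<subseteq> edges G)" for l
    unfolding is_copy_cycle_iff cycle_copies_def by auto
  show ?thesis unfolding girth_def copy
  proof (rule antisym)
    show "Inf {enat l |l. 3 \<le> l \<and> (\<exists>E\<in>cycle_copies l (verts G). E \<subseteq> edges G)} \<le> enat k"
      using assms(1,2) by (intro Inf_lower) blast
    show "enat k \<le> Inf {enat l |l. 3 \<le> l \<and> (\<exists>E\<in>cycle_copies l (verts G). E \<subseteq> edges G)}"
    proof (rule Inf_greatest)
      fix x assume "x \<in> {enat l |l. 3 \<le> l \<and> (\<exists>E\<in>cycle_copies l (verts G). E \<subseteq> edges G)}"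
      then obtain l E where l: "x = enat l" "3 \<le> l" "E \<in> cycle_copies l (verts G)" "E \<subseteq> edges G" by blast
      then have "\<not> l < k" using assms(3) by blast
      then show "enat k \<le> x" using l(1) by simp
    qed
  qed
qed

theorem theorem1p1:
  fixes k r R :: nat
  assumes "k \<ge> 4" and "r \<ge> 2"
    and "R = ramsey_number (cycle_graph k) r"
  shows "\<exists>H :: nat graph. finite_simple_graph H
           \<and> card (verts H) = k ^ (15 * k ^ 3) * R ^ (10 * k ^ 2)
           \<and> girth H = enat k
           \<and> arrows H (cycle_graph k) r"
proof -
  have r1: "1 \<le> r" using assms(2) by simp
  have kR: "k \<le> R" "r + 2 \<le> R"
    unfolding assms(3) using ramsey_number_cycle_ge[OF r1 assms(1)] by auto
  define m where "m = k ^ (15 * k\<^sup>2) * R ^ (10 * k)"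
  define n where "n = m ^ (k - 1)"
  define a where "a = k\<^sup>2 * R\<^sup>2"
  define b where "b = k ^ (4 * k) * R ^ 6"
  define z where "z = 4 * k * (b * m) ^ (k - 1)"
  define q where "q = real b / real m ^ (k - 2)"
  define \<tau> where "\<tau> = real k * 2 ^ (k + 2) * (real a / real m ^ (k - 2)) * real (n choose 2)"
  interpret girth_ramsey_parameters k r R m n a b z q \<tau>
    by unfold_locales (use assms(1) kR in \<open>simp_all add: m_def n_def a_def b_def z_def q_def \<tau>_def\<close>)
  have floor: "\<tau> < real (nat \<lfloor>\<tau>\<rfloor>) + 1" by linarith
  have "\<exists>F\<subseteq>nsets {..<n} 2.
    (\<forall>l. 3 \<le> l \<longrightarrow> l < k \<longrightarrow> (\<forall>E\<in>cycle_copies l {..<n}. \<not> E \<subseteq> F)) \<and>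
    (\<forall>c. (\<forall>e\<in>F. c e < r) \<longrightarrow>
      (\<exists>E\<in>cycle_copies k {..<n}. E \<subseteq> F \<and> (\<exists>i<r. \<forall>e\<in>E. c e = i)))"
    by (rule cycle_ramsey_edge_set[OF assms(1) r1 assms(3), of n m a q z "nat \<lfloor>\<tau>\<rfloor>"])
      (use n_def R_le_n a_pos two_a_le a_power_le_m r_power_le_a_power q_bounds z_pos short_cycles floor union_bound
        in \<open>simp_all only: \<tau>_def\<close>)
  then obtain F where F: "F \<subseteq> nsets {..<n} 2"
    and F1: "\<forall>l. 3 \<le> l \<longrightarrow> l < k \<longrightarrow> (\<forall>E\<in>cycle_copies l {..<n}. \<not> E \<subseteq> F)"
    and F2: "\<forall>c. (\<forall>e\<in>F. c e < r) \<longrightarrow>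
      (\<exists>E\<in>cycle_copies k {..<n}. E \<subseteq> F \<and> (\<exists>i<r. \<forall>e\<in>E. c e = i))"
    by (elim exE conjE)
  \<comment> \<open>The vertices from \<open>n\<close> on are isolated and bring the order to
    \<open>m ^ k\<close>.\<close>
  define H where "H = \<lparr>verts = {..<m ^ k}, edges = F\<rparr>"
  have sub: "{..<n} \<subseteq> {..<m ^ k}" using size(2) by auto
  have vH: "verts H = {..<m ^ k}" and eH: "edges H = F" by (simp_all add: H_def)
  have arr: "\<exists>E\<in>cycle_copies k (verts H). E \<subseteq> edges H \<and> (\<exists>i<r. \<forall>e\<in>E. c e = i)"
    if "\<forall>e\<in>edges H. c e < r" for c
  proof -
    have "\<forall>e\<in>F. c e < r" using that by (simp only: eH)
    from mp[OF spec[OF F2] this] obtain E where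
      "E \<in> cycle_copies k {..<n}" "E \<subseteq> F \<and> (\<exists>i<r. \<forall>e\<in>E. c e = i)" by (rule bexE)
    then show ?thesis unfolding vH eH using subsetD[OF cycle_copies_mono[OF sub]] by (intro bexI[of _ E])
  qed
  have "girth H = enat k"
  proof (rule girth_eqI)
    \<comment> \<open>Applied to a constant colouring, the Ramsey property yields a cycle of length
      exactly \<open>k\<close>.\<close>
    show "\<exists>E\<in>cycle_copies k (verts H). E \<subseteq> edges H" using arr[of "\<lambda>_. 0"] r1 by auto
    show "\<not> E \<subseteq> edges H" if l: "3 \<le> l" "l < k" and E: "E \<in> cycle_copies l (verts H)" for l E
    proof
      assume "E \<subseteq> edges H"
      then have "E \<subseteq> F" by (simp only: eH)
      moreover from this have "E \<in> cycle_copies l {..<n}"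
        using F by (intro cycle_copies_restrict[OF E _ l(1)]) (rule subset_trans)
      ultimately show False using F1 l by blast
    qed
  qed (use assms(1) in simp)
  moreover have "finite_simple_graph H"
    unfolding finite_simple_graph_def vH eH using F nsets_mono[OF sub, of 2] by auto
  moreover have "card (verts H) = k ^ (15 * k ^ 3) * R ^ (10 * k ^ 2)"
    unfolding vH card_lessThan by (rule size(1))
  moreover have "arrows H (cycle_graph k) r"
    unfolding arrows_cycle_iff using arr by blast
  ultimately show ?thesis by blast
qed

end
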